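(* The knots $9_{35}$, $9_{37}$, $9_{41}$, $9_{46}$, $9_{47}$, $9_{48}$, $9_{49}$, $10_{74}$, $10_{75}$, $10_{103}$, $10_{155}$, $10_{157}$ of the Rolfsen knot table are not bipartite.
   Context: Matched pairs: a matched pair of crossings in a knot diagram is a pair of crossings contained in a disc $D$ of the plane such that the diagram meets $D$ in exactly two arcs, which cross each other exactly twice (these are the two crossings of the pair), bound a bigon between the two crossings, and form a full twist (two half-twists in the same direction, so that each arc passes over the other exactly once; in particular the pair cannot be removed by a Reidemeister II move inside $D$); moreover, the two arcs, twisted around each other, run in opposite directions (are counter-directed) with respect to an orientation of the knot (this does not depend on which of the two orientations is chosen). Both directions of twisting are allowed (positive and negative pairs). A knot diagram is matched if the set of all its crossings is split into matched pairs, with pairwise disjoint discs. A knot is bipartite if it can be represented by a matched diagram. Knots are named as in the standard Rolfsen table of prime knots with up to 10 crossings (as in the Knot Atlas); $9_{46}$ is the pretzel knot with parameters $(3,3,-3)$. *)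

theory Defs
  imports "HOL-Library.Multiset" "HOL-Library.Disjoint_Sets" "HOL-Combinatorics.Orbits"
begin

section \<open>Knot diagrams\<close>

text \<open>
  Diagrams are encoded by planar diagram (PD) codes.  A diagram is a 4-valent graph on the
  sphere, whose edges carry labels.  \<open>Crossing a b c d\<close> lists the labels of the four edge ends
  at a crossing in counterclockwise order; \<open>a\<close> and \<open>c\<close> belong to the lower strand, \<open>b\<close> and \<open>d\<close>
  to the upper one.  \<open>Point a b\<close> is an auxiliary marked point which subdivides a strand into the
  edges \<open>a\<close> and \<open>b\<close>; marked points make the Reidemeister moves purely local, and allow a circle
  without crossings to be written as \<open>[Point a a]\<close>.

  Working on the sphere rather than in the plane does not change the knots that are represented.
  It does not change bipartiteness either: a diagram split into \<open>n\<close> matched pairs has \<open>2 * n + 2\<close>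
  faces, so the point at infinity can be put into a face which is not one of the \<open>n\<close> bigons.
\<close>

datatype 'a vertex = Crossing 'a 'a 'a 'a | Point 'a 'a

type_synonym diagram = "nat vertex list"

fun ends :: "'a vertex \<Rightarrow> 'a list" where
  "ends (Crossing a b c d) = [a, b, c, d]"
| "ends (Point a b) = [a, b]"

fun is_crossing :: "'a vertex \<Rightarrow> bool" where
  "is_crossing (Crossing a b c d) = True"
| "is_crossing (Point a b) = False"

text \<open>A dart \<open>(i, k)\<close> is the \<open>k\<close>-th edge end at the \<open>i\<close>-th vertex.\<close>

type_synonym dart = "nat \<times> nat"

definition darts :: "diagram \<Rightarrow> dart set" where
  "darts D = {(i, k). i < length D \<and> k < length (ends (D ! i))}"

definition label :: "diagram \<Rightarrow> dart \<Rightarrow> nat" where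
  "label D = (\<lambda>(i, k). ends (D ! i) ! k)"

definition well_labelled :: "diagram \<Rightarrow> bool" where
  "well_labelled D \<longleftrightarrow> (\<forall>d\<in>darts D. \<exists>!d'. d' \<in> darts D \<and> d' \<noteq> d \<and> label D d' = label D d)"

text \<open>The other end of the same edge.\<close>

definition mate :: "diagram \<Rightarrow> dart \<Rightarrow> dart" where
  "mate D d = (THE d'. d' \<in> darts D \<and> d' \<noteq> d \<and> label D d' = label D d)"

text \<open>The next edge end counterclockwise at the same vertex, and the continuation of the same
  strand through the vertex.\<close>

definition ccw :: "diagram \<Rightarrow> dart \<Rightarrow> dart" where
  "ccw D = (\<lambda>(i, k). (i, (k + 1) mod length (ends (D ! i))))"

definition across :: "diagram \<Rightarrow> dart \<Rightarrow> dart" where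
  "across D = (\<lambda>(i, k). (i, (k + length (ends (D ! i)) div 2) mod length (ends (D ! i))))"

text \<open>Every two darts lie on a common closed strand, so the diagram has a single component.\<close>

definition one_component :: "diagram \<Rightarrow> bool" where
  "one_component D \<longleftrightarrow>
     (\<forall>d\<in>darts D. \<forall>d'\<in>darts D.
        (d, d') \<in> ({(e, mate D e) | e. e \<in> darts D} \<union> {(e, across D e) | e. e \<in> darts D})\<^sup>*)"

definition faces :: "diagram \<Rightarrow> dart set set" where
  "faces D = orbit (ccw D \<circ> mate D) ` darts D"

text \<open>Euler's formula \<open>V + F = E + 2\<close>: the (connected) diagram lies on a sphere.\<close>

definition planar :: "diagram \<Rightarrow> bool" where
  "planar D \<longleftrightarrow> length D + card (faces D) = card (darts D) div 2 + 2"

definition knot_diagram :: "diagram \<Rightarrow> bool" where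
  "knot_diagram D \<longleftrightarrow> well_labelled D \<and> one_component D \<and> planar D"


section \<open>Knots\<close>

text \<open>
  The first five rules only change the encoding of a diagram.  In \<open>R2\<close> the two edges \<open>x\<close> and \<open>y\<close>
  bound a bigon, and the strand through \<open>y\<close> is the upper one at both of its corners.  In the \<open>R3\<close>
  rules the strands \<open>a1 a2\<close>, \<open>b1 b2\<close> and \<open>c1 c2\<close> bound a triangle with the sides \<open>x\<close>, \<open>y\<close>, \<open>z\<close>,
  respectively, and \<open>c1 c2\<close> is the top strand; the bottom one is \<open>a1 a2\<close> in \<open>R3a\<close> and \<open>b1 b2\<close> in
  \<open>R3b\<close>.  The relation is closed under symmetry only later.
\<close>

inductive move :: "diagram \<Rightarrow> diagram \<Rightarrow> bool" where
  permute: "mset D = mset D' \<Longrightarrow> move D D'"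
| rename: "inj_on f (\<Union>(set_vertex ` set D)) \<Longrightarrow> move D (map (map_vertex f) D)"
| turn_crossing: "move (Crossing a b c d # D) (Crossing c d a b # D)"
| turn_point: "move (Point a b # D) (Point b a # D)"
| absorb: "a \<noteq> b \<Longrightarrow> move (Point a b # D) (map (map_vertex (id(b := a))) D)"
| R1a: "move (Crossing a x x b # D) (Point a b # D)"
| R1b: "move (Crossing x x b a # D) (Point a b # D)"
| R2: "move (Crossing a b x y # Crossing x d c y # D) (Point a c # Point b d # D)"
| R3a: "move (Crossing x y a1 b1 # Crossing a2 z x c1 # Crossing b2 c2 y z # D)
             (Crossing a2 b2 x y # Crossing x c2 a1 z # Crossing y z b1 c1 # D)"
| R3b: "move (Crossing y a1 b1 x # Crossing a2 z x c1 # Crossing b2 c2 y z # D)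
             (Crossing b2 x y a2 # Crossing x c2 a1 z # Crossing y z b1 c1 # D)"

definition reidemeister_equivalent :: "diagram \<Rightarrow> diagram \<Rightarrow> bool" where
  "reidemeister_equivalent = equivclp (\<lambda>D D'. knot_diagram D \<and> knot_diagram D' \<and> move D D')"

text \<open>A knot is identified with the set of all diagrams that represent it.  Knots are not
  oriented.\<close>

type_synonym knot = "diagram set"

definition knot_of :: "diagram \<Rightarrow> knot" where
  "knot_of D = {D'. knot_diagram D' \<and> reidemeister_equivalent D D'}"


section \<open>Matched diagrams and bipartite knots\<close>

text \<open>\<open>out d\<close> means that the oriented knot leaves the vertex along the dart \<open>d\<close>.\<close>

definition orientation :: "diagram \<Rightarrow> (dart \<Rightarrow> bool) \<Rightarrow> bool" where
  "orientation D out \<longleftrightarrow> (\<forall>d\<in>darts D. out (mate D d) \<noteq> out d \<and> out (across D d) \<noteq> out d)"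

definition over :: "dart \<Rightarrow> bool" where
  "over d \<longleftrightarrow> odd (snd d)"

text \<open>
  The edge with ends \<open>p\<close>, \<open>p'\<close> and the edge with ends \<open>q\<close>, \<open>q'\<close> join the crossings \<open>i\<close> and \<open>j\<close>, and
  bound a bigon face; the disc is a neighbourhood of this bigon and of its two corners.  Each of
  the two arcs passes over at exactly one of its crossings, and the arcs run through the bigon in
  opposite directions.
\<close>

definition matched_pair :: "diagram \<Rightarrow> (dart \<Rightarrow> bool) \<Rightarrow> nat \<Rightarrow> nat \<Rightarrow> bool" where
  "matched_pair D out i j \<longleftrightarrow>
     i < length D \<and> j < length D \<and> i \<noteq> j \<and> is_crossing (D ! i) \<and> is_crossing (D ! j) \<and>
     (\<exists>p q p' q'. {p, q, p', q'} \<subseteq> darts D \<and> fst p = i \<and> fst q' = j \<and>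
        q = ccw D p \<and> p' = ccw D q' \<and> mate D p = p' \<and> mate D q = q' \<and>
        over p \<noteq> over p' \<and> over q \<noteq> over q' \<and> out p \<noteq> out q)"

text \<open>Disjoint pairs of crossings have disjoint discs, as distinct faces are disjoint.\<close>

definition matched :: "diagram \<Rightarrow> bool" where
  "matched D \<longleftrightarrow>
     (\<exists>out P. orientation D out \<and> partition_on {i. i < length D \<and> is_crossing (D ! i)} P \<and>
        (\<forall>B\<in>P. \<exists>i j. B = {i, j} \<and> matched_pair D out i j))"

definition bipartite :: "knot \<Rightarrow> bool" where
  "bipartite K \<longleftrightarrow> (\<exists>D\<in>K. matched D)"


section \<open>Knots of the Rolfsen table\<close>

text \<open>
  Minimal diagrams, realising the Dowker--Thistlethwaite codes given in the comments: the \<open>n\<close>-th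
  entry is the even number paired with \<open>2 * n - 1\<close>, and the sign marks the crossings at which
  the diagram does not alternate.  As in the usual PD notation, the edges are numbered along the
  knot, and each crossing starts with the incoming lower edge.  The table lists knots up to mirror
  image; the mirror image of a bipartite knot is bipartite, as pairs of both signs are allowed.
\<close>

(* 8 12 16 14 18 4 2 6 10 *)
definition rolfsen_9_35 :: knot where
  "rolfsen_9_35 = knot_of
    [Crossing 8 2 9 1, Crossing 12 4 13 3, Crossing 16 6 17 5, Crossing 14 8 15 7,
     Crossing 18 10 1 9, Crossing 4 12 5 11, Crossing 2 14 3 13, Crossing 6 16 7 15,
     Crossing 10 18 11 17]"

(* 4 10 14 12 16 2 6 18 8 *)
definition rolfsen_9_37 :: knot where
  "rolfsen_9_37 = knot_of
    [Crossing 4 2 5 1, Crossing 10 3 11 4, Crossing 14 6 15 5, Crossing 12 8 13 7,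
     Crossing 16 9 17 10, Crossing 2 11 3 12, Crossing 6 14 7 13, Crossing 18 16 1 15,
     Crossing 8 17 9 18]"

(* 6 10 14 12 16 2 18 4 8 *)
definition rolfsen_9_41 :: knot where
  "rolfsen_9_41 = knot_of
    [Crossing 6 2 7 1, Crossing 10 3 11 4, Crossing 14 5 15 6, Crossing 12 8 13 7,
     Crossing 16 9 17 10, Crossing 2 11 3 12, Crossing 18 14 1 13, Crossing 4 15 5 16,
     Crossing 8 17 9 18]"

(* 8 12 -16 -14 18 4 2 -6 10 (pretzel knot with parameters 3, 3, -3) *)
definition rolfsen_9_46 :: knot where
  "rolfsen_9_46 = knot_of
    [Crossing 8 2 9 1, Crossing 12 4 13 3, Crossing 5 16 6 17, Crossing 7 14 8 15,
     Crossing 18 10 1 9, Crossing 4 12 5 11, Crossing 2 14 3 13, Crossing 15 6 16 7,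
     Crossing 10 18 11 17]"

(* 6 8 10 16 14 -18 4 2 -12 *)
definition rolfsen_9_47 :: knot where
  "rolfsen_9_47 = knot_of
    [Crossing 6 2 7 1, Crossing 8 3 9 4, Crossing 10 6 11 5, Crossing 16 8 17 7,
     Crossing 14 9 15 10, Crossing 11 1 12 18, Crossing 4 14 5 13, Crossing 2 15 3 16,
     Crossing 17 13 18 12]"

(* 4 10 -14 -12 16 2 -6 18 8 *)
definition rolfsen_9_48 :: knot where
  "rolfsen_9_48 = knot_of
    [Crossing 4 2 5 1, Crossing 10 3 11 4, Crossing 5 14 6 15, Crossing 7 12 8 13,
     Crossing 16 9 17 10, Crossing 2 11 3 12, Crossing 13 6 14 7, Crossing 18 16 1 15,
     Crossing 8 17 9 18]"

(* 6 -10 -14 12 -16 -2 18 -4 -8 *)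
definition rolfsen_9_49 :: knot where
  "rolfsen_9_49 = knot_of
    [Crossing 6 2 7 1, Crossing 3 11 4 10, Crossing 5 15 6 14, Crossing 12 8 13 7,
     Crossing 9 17 10 16, Crossing 11 3 12 2, Crossing 18 14 1 13, Crossing 15 5 16 4,
     Crossing 17 9 18 8]"

(* 4 12 14 16 20 18 2 8 6 10 *)
definition rolfsen_10_74 :: knot where
  "rolfsen_10_74 = knot_of
    [Crossing 4 2 5 1, Crossing 12 3 13 4, Crossing 14 6 15 5, Crossing 16 8 17 7,
     Crossing 20 10 1 9, Crossing 18 12 19 11, Crossing 2 13 3 14, Crossing 8 16 9 15,
     Crossing 6 18 7 17, Crossing 10 20 11 19]"

(* 4 10 12 14 18 2 16 6 20 8 *)
definition rolfsen_10_75 :: knot where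
  "rolfsen_10_75 = knot_of
    [Crossing 4 2 5 1, Crossing 10 3 11 4, Crossing 12 6 13 5, Crossing 14 7 15 8,
     Crossing 18 9 19 10, Crossing 2 11 3 12, Crossing 16 14 17 13, Crossing 6 15 7 16,
     Crossing 20 18 1 17, Crossing 8 19 9 20]"

(* 6 10 18 16 14 4 20 8 2 12 *)
definition rolfsen_10_103 :: knot where
  "rolfsen_10_103 = knot_of
    [Crossing 6 2 7 1, Crossing 10 3 11 4, Crossing 18 6 19 5, Crossing 16 7 17 8,
     Crossing 14 9 15 10, Crossing 4 11 5 12, Crossing 20 13 1 14, Crossing 8 15 9 16,
     Crossing 2 18 3 17, Crossing 12 19 13 20]"

(* 6 10 14 16 18 4 -20 2 8 -12 *)
definition rolfsen_10_155 :: knot where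
  "rolfsen_10_155 = knot_of
    [Crossing 6 2 7 1, Crossing 10 3 11 4, Crossing 14 5 15 6, Crossing 16 8 17 7,
     Crossing 18 10 19 9, Crossing 4 11 5 12, Crossing 13 20 14 1, Crossing 2 15 3 16,
     Crossing 8 18 9 17, Crossing 19 12 20 13]"

(* 6 -10 -18 14 -2 -16 20 8 -4 12 *)
definition rolfsen_10_157 :: knot where
  "rolfsen_10_157 = knot_of
    [Crossing 6 2 7 1, Crossing 3 10 4 11, Crossing 5 18 6 19, Crossing 14 7 15 8,
     Crossing 9 2 10 3, Crossing 11 17 12 16, Crossing 20 13 1 14, Crossing 8 15 9 16,
     Crossing 17 4 18 5, Crossing 12 19 13 20]"

end

theory Submission
  imports Defs "HOL-Library.FuncSet" "HOL-Library.Numeral_Type"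
begin

text \<open>
  The proof looks at the Alexander module near \<open>t = - 1\<close>. Put \<open>t = - 1 + s\<close> with \<open>s\<^sup>2 = 0\<close>. A
  colouring of the arcs by elements \<open>f + s * g\<close> that satisfies the Alexander relation
  \<open>out = t * in + (1 - t) * over\<close> (with \<open>1 / t\<close> for \<open>t\<close> at a negative crossing) consists of a
  Fox colouring \<open>f\<close>, for which \<open>in + out = 2 * over\<close>, and of a first-order part \<open>g\<close>, for which
  \<open>in + out - 2 * over\<close> equals the difference of \<open>f\<close> between the edge to the right of the upper
  strand and the upper strand itself. So only the direction of the upper strand matters. A
  diagram is called \<open>liftable\<close> over a ring if all its Fox colourings can be completed to such
  pairs. Colourings correspond to each other under Reidemeister moves, so this is a property of
  the knot (\<open>liftable_knot_of\<close>).

  Bipartite knots are liftable over every finite ring (\<open>matched_liftable\<close>). Untwisting all the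
  matched pairs turns a matched diagram into a simple closed curve on the sphere, with a chord
  for each pair on its left or on its right. Along the curve a Fox colouring \<open>f\<close> jumps at the
  two feet of each chord by opposite amounts. Chords on the same side do not cross, so \<open>f\<close> is
  the difference of a function on the regions to the left of the curve and one on the regions to
  the right. The value \<open>g\<close> of this potential on the left of each edge takes over the jumps at
  the left chords and none of the jumps at the right ones, and this is just what the equations
  ask for, for twice the first-order part. In terms of matrices: the Alexander module is
  presented by \<open>t * E + (1 - t)\<^sup>2 * M\<close>, where \<open>E\<close> and \<open>M\<close> are integral, and \<open>(1 - t)\<^sup>2\<close> is
  \<open>- 4 * t\<close> modulo \<open>(1 + t)\<^sup>2\<close>, so to first order the presentation matrix is a constant times
  \<open>t\<close>.

  The potential comes from planarity in its algebraic form (\<open>closed_imp_face_potential\<close>): by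
  Euler's formula, an antisymmetric function on the darts with sum zero at each vertex is the
  difference of the values of a function on the two adjacent faces. It is obtained by counting,
  which is why the ring is finite.

  Each of the twelve knots has a Fox colouring modulo 3, 5 or 7 that does not lift. The
  equations for \<open>g\<close> are linear, so a combination of them in which all the unknowns cancel, while
  the right-hand sides do not, proves this (\<open>certificate_not_liftable\<close>).
\<close>

section \<open>Orientations, Fox colourings and their lifts\<close>

text \<open>
  An orientation is stored in the vertices instead of the darts, as vertices are what the moves
  act on. In \<open>(v, u, w)\<close> the sign \<open>u\<close> is \<open>1\<close> if the strand \<open>a c\<close> of a crossing (or \<open>a b\<close> of a
  point) runs from its first to its second end, and \<open>w\<close> tells the same about the strand \<open>b d\<close>.
  The flow counts an edge with \<open>1\<close> where the knot leaves the vertex along it, so the signs fit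
  together if the total flow vanishes on every edge.
\<close>

type_synonym decorated_vertex = "nat vertex \<times> int \<times> int"

fun flow :: "decorated_vertex \<Rightarrow> nat \<Rightarrow> int" where
  "flow (Crossing a b c d, u, w) l =
     u * (of_bool (l = c) - of_bool (l = a)) + w * (of_bool (l = d) - of_bool (l = b))"
| "flow (Point a b, u, w) l = u * (of_bool (l = b) - of_bool (l = a))"

definition signed :: "decorated_vertex list \<Rightarrow> bool" where
  "signed W \<longleftrightarrow> (\<forall>(v, u, w)\<in>set W. u \<in> {1, - 1} \<and> w \<in> {1, - 1})"

definition total_flow :: "decorated_vertex list \<Rightarrow> nat \<Rightarrow> int" where
  "total_flow W l = (\<Sum>x\<leftarrow>W. flow x l)"

definition fox_at :: "'k::comm_ring_1 \<Rightarrow> 'k \<Rightarrow> 'k \<Rightarrow> 'k \<Rightarrow> bool" where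
  "fox_at a b c d \<longleftrightarrow> b = d \<and> c = 2 * b - a"

fun fox :: "(nat \<Rightarrow> 'k::comm_ring_1) \<Rightarrow> nat vertex \<Rightarrow> bool" where
  "fox f (Crossing a b c d) \<longleftrightarrow> fox_at (f a) (f b) (f c) (f d)"
| "fox f (Point a b) \<longleftrightarrow> f a = f b"

text \<open>
  With \<open>w = 1\<close> the upper strand runs from \<open>b\<close> to \<open>d\<close>, and \<open>c\<close> lies to its right. The factor \<open>2\<close>
  replaces the first-order part \<open>g\<close> by its double; it lets matched diagrams be lifted without
  dividing by \<open>2\<close>.
\<close>

definition lift_at ::
  "int \<Rightarrow> 'k::comm_ring_1 \<Rightarrow> 'k \<Rightarrow> 'k \<Rightarrow> 'k \<Rightarrow> 'k \<Rightarrow> 'k \<Rightarrow> bool" where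
  "lift_at w b c a' b' c' d' \<longleftrightarrow> b' = d' \<and> c' = 2 * b' - a' + of_int w * 2 * (c - b)"

fun lift :: "(nat \<Rightarrow> 'k::comm_ring_1) \<Rightarrow> (nat \<Rightarrow> 'k) \<Rightarrow> decorated_vertex \<Rightarrow> bool" where
  "lift f g (Crossing a b c d, u, w) \<longleftrightarrow> lift_at w (f b) (f c) (g a) (g b) (g c) (g d)"
| "lift f g (Point a b, u, w) \<longleftrightarrow> g a = g b"

text \<open>
  Reversing the orientation negates \<open>g\<close>, so for a knot it makes no difference that one
  orientation is asked for instead of all.
\<close>

definition liftable :: "'k::comm_ring_1 itself \<Rightarrow> diagram \<Rightarrow> bool" where
  "liftable _ D \<longleftrightarrow>
     (\<exists>W. map fst W = D \<and> signed W \<and> (\<forall>l. total_flow W l = 0) \<and>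
        (\<forall>f :: nat \<Rightarrow> 'k. (\<forall>v\<in>set D. fox f v) \<longrightarrow> (\<exists>g. \<forall>x\<in>set W. lift f g x)))"

abbreviation labels :: "diagram \<Rightarrow> nat set" where
  "labels D \<equiv> \<Union>(set_vertex ` set D)"

lemma total_flow_simps [simp]:
  "total_flow [] l = 0" "total_flow (x # W) l = flow x l + total_flow W l"
  "total_flow (W @ W') l = total_flow W l + total_flow W' l"
  by (simp_all add: total_flow_def)

lemma signed_simps [simp]:
  "signed []" "signed ((v, u, w) # W) \<longleftrightarrow> u \<in> {1, - 1} \<and> w \<in> {1, - 1} \<and> signed W"
  "signed (W @ W') \<longleftrightarrow> signed W \<and> signed W'"
  unfolding signed_def by (simp_all add: ball_Un)

lemma fox_cong: "(\<And>l. l \<in> set_vertex v \<Longrightarrow> f l = f' l) \<Longrightarrow> fox f v = fox f' v"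
  by (cases v) auto

lemma lift_cong:
  "(\<And>l. l \<in> set_vertex (fst x) \<Longrightarrow> f l = f' l) \<Longrightarrow> (\<And>l. l \<in> set_vertex (fst x) \<Longrightarrow> g l = g' l) \<Longrightarrow>
   lift f g x = lift f' g' x"
  by (cases x; cases "fst x") auto

lemma fox_map: "fox f (map_vertex h v) = fox (f \<circ> h) v"
  by (cases v) auto

lemma lift_map: "lift f g (map_vertex h v, s) = lift (f \<circ> h) (g \<circ> h) (v, s)"
  by (cases v; cases s) auto

lemma flow_outside: "l \<notin> set_vertex (fst x) \<Longrightarrow> flow x l = 0"
  by (cases x; cases "fst x") auto

lemma total_flow_outside: "l \<notin> labels (map fst W) \<Longrightarrow> total_flow W l = 0"
  by (induction W) (auto simp: flow_outside)

lemma total_flow_mset: "mset W = mset W' \<Longrightarrow> total_flow W l = total_flow W' l"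
  unfolding total_flow_def by (metis mset_map sum_mset_sum_list)

lemma map_fst_perm:
  "mset D = mset (map fst W) \<Longrightarrow> \<exists>W'. map fst W' = D \<and> mset W' = mset W"
proof (induction D arbitrary: W)
  case Nil
  then show ?case by simp
next
  case (Cons v D)
  then have "v \<in> set (map fst W)" by (metis list.set_intros(1) mset_eq_setD)
  then obtain s where s: "(v, s) \<in> set W" by auto
  then obtain R where W: "mset W = add_mset (v, s) (mset R)"
    by (metis multi_member_split ex_mset set_mset_mset)
  have "mset D = mset (map fst R)"
    using Cons.prems W by simp
  from Cons.IH[OF this] obtain W' where "map fst W' = D" "mset W' = mset R" by blast
  then have "map fst ((v, s) # W') = v # D \<and> mset ((v, s) # W') = mset W" using W by simp
  then show ?case by (rule exI)
qed

lemma liftableI: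
  assumes "map fst W = D" "signed W" "\<And>l. total_flow W l = 0"
    "\<And>f :: nat \<Rightarrow> 'k::comm_ring_1. \<forall>v\<in>set D. fox f v \<Longrightarrow> \<exists>g. \<forall>x\<in>set W. lift f g x"
  shows "liftable TYPE('k) D"
  unfolding liftable_def using assms by (intro exI[of _ W] conjI allI impI)

lemma liftableE:
  assumes "liftable TYPE('k::comm_ring_1) D"
  obtains W where "map fst W = D" "signed W" "\<forall>l. total_flow W l = 0"
    "\<And>f :: nat \<Rightarrow> 'k. \<forall>v\<in>set D. fox f v \<Longrightarrow> \<exists>g. \<forall>x\<in>set W. lift f g x"
proof -
  from assms[unfolded liftable_def] obtain W where W: "map fst W = D" "signed W"
    "\<forall>l. total_flow W l = 0"
    "\<forall>f :: nat \<Rightarrow> 'k. (\<forall>v\<in>set D. fox f v) \<longrightarrow> (\<exists>g. \<forall>x\<in>set W. lift f g x)"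
    by (elim exE conjE) (rule that)
  show ?thesis by (rule that[OF W(1-3) W(4)[THEN spec, THEN mp]])
qed

lemma liftable_permute:
  assumes "mset D = mset D'" "liftable TYPE('k::comm_ring_1) D"
  shows "liftable TYPE('k) D'"
proof -
  from assms(2) obtain W where W: "map fst W = D" "signed W" "\<forall>l. total_flow W l = 0"
    "\<And>f :: nat \<Rightarrow> 'k. \<forall>v\<in>set D. fox f v \<Longrightarrow> \<exists>g. \<forall>x\<in>set W. lift f g x"
    by (rule liftableE) (rule that)
  obtain W' where W': "map fst W' = D'" "mset W' = mset W"
    using map_fst_perm[of D' W] W(1) assms(1) by metis
  have s: "set W' = set W" "set D' = set D"
    using mset_eq_setD[OF W'(2)] mset_eq_setD[OF assms(1)] by simp_all
  have "signed W'" using W(2) unfolding signed_def s .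
  moreover have "total_flow W' l = 0" for l
    using W(3) total_flow_mset[OF W'(2)] by simp
  ultimately show ?thesis
    using W(4) unfolding s[symmetric] by (rule liftableI[OF W'(1)])
qed

text \<open>
  A decorated tangle \<open>W\<close> may be replaced by \<open>W'\<close> if both have the same flow through their
  boundary, and colourings and lifts can be carried over by changing them only on the set \<open>S\<close> of
  inner edges. Fox colourings go from \<open>W'\<close> to \<open>W\<close>, and their lifts back from \<open>W\<close> to \<open>W'\<close>.
\<close>

definition local_lift ::
  "'k::comm_ring_1 itself \<Rightarrow> nat set \<Rightarrow> decorated_vertex list \<Rightarrow>
   decorated_vertex list \<Rightarrow> bool" where
  "local_lift _ S W W' \<longleftrightarrow> signed W' \<and>
     (\<forall>l. total_flow W' l = (if l \<in> S then 0 else total_flow W l)) \<and>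
     (\<forall>f' :: nat \<Rightarrow> 'k. (\<forall>v\<in>set (map fst W'). fox f' v) \<longrightarrow>
       (\<exists>f. (\<forall>l. l \<notin> S \<longrightarrow> f l = f' l) \<and> (\<forall>v\<in>set (map fst W). fox f v) \<and>
         (\<forall>g. (\<forall>x\<in>set W. lift f g x) \<longrightarrow>
           (\<exists>g'. (\<forall>l. l \<notin> S \<longrightarrow> g' l = g l) \<and> (\<forall>x\<in>set W'. lift f' g' x)))))"

lemma local_liftI:
  fixes F :: "(nat \<Rightarrow> 'k::comm_ring_1) \<Rightarrow> nat \<Rightarrow> 'k"
    and G :: "(nat \<Rightarrow> 'k) \<Rightarrow> (nat \<Rightarrow> 'k) \<Rightarrow> nat \<Rightarrow> 'k"
  assumes "signed W'" "\<And>l. total_flow W' l = (if l \<in> S then 0 else total_flow W l)"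
    and "\<And>f l. l \<notin> S \<Longrightarrow> F f l = f l" "\<And>f g l. l \<notin> S \<Longrightarrow> G f g l = g l"
    and "\<And>f. \<forall>v\<in>set (map fst W'). fox f v \<Longrightarrow> \<forall>v\<in>set (map fst W). fox (F f) v"
    and "\<And>f g. \<lbrakk>\<forall>v\<in>set (map fst W'). fox f v; \<forall>x\<in>set W. lift (F f) g x\<rbrakk> \<Longrightarrow>
      \<forall>x\<in>set W'. lift f (G f g) x"
  shows "local_lift TYPE('k) S W W'"
  unfolding local_lift_def
proof (intro conjI allI impI)
  fix f :: "nat \<Rightarrow> 'k" assume f: "\<forall>v\<in>set (map fst W'). fox f v"
  show "\<exists>f'. (\<forall>l. l \<notin> S \<longrightarrow> f' l = f l) \<and> (\<forall>v\<in>set (map fst W). fox f' v) \<and>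
    (\<forall>g. (\<forall>x\<in>set W. lift f' g x) \<longrightarrow>
      (\<exists>g'. (\<forall>l. l \<notin> S \<longrightarrow> g' l = g l) \<and> (\<forall>x\<in>set W'. lift f g' x)))"
  proof (rule exI[of _ "F f"], intro conjI allI impI)
    fix g :: "nat \<Rightarrow> 'k" assume "\<forall>x\<in>set W. lift (F f) g x"
    then have "\<forall>x\<in>set W'. lift f (G f g) x" by (rule assms(6)[OF f])
    then show "\<exists>g'. (\<forall>l. l \<notin> S \<longrightarrow> g' l = g l) \<and> (\<forall>x\<in>set W'. lift f g' x)"
      using assms(4) by (intro exI[of _ "G f g"] conjI allI impI)
  qed (use assms(3,5) f in \<open>simp_all\<close>)
qed (rule assms(1,2))+

lemma liftable_local:
  assumes S: "S \<inter> labels R = {}"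
    and H: "\<And>W. \<lbrakk>map fst W = L; signed W; \<forall>l\<in>S. total_flow W l = 0\<rbrakk> \<Longrightarrow>
      \<exists>W'. map fst W' = L' \<and> local_lift TYPE('k) S W W'"
    and L: "liftable TYPE('k::comm_ring_1) (L @ R)"
  shows "liftable TYPE('k) (L' @ R)"
proof -
  from L obtain W where W: "map fst W = L @ R" "signed W" "\<forall>l. total_flow W l = 0"
    "\<And>f :: nat \<Rightarrow> 'k. \<forall>v\<in>set (L @ R). fox f v \<Longrightarrow> \<exists>g. \<forall>x\<in>set W. lift f g x"
    by (rule liftableE) (rule that)
  obtain A B where AB: "W = A @ B" "map fst A = L" "map fst B = R"
    using W(1) unfolding map_eq_append_conv by (elim exE conjE) (rule that, simp_all)
  have B0: "total_flow B l = 0" if "l \<in> S" for l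
  proof (rule total_flow_outside)
    show "l \<notin> labels (map fst B)" using S that unfolding AB(3) by blast
  qed
  have A0: "\<forall>l\<in>S. total_flow A l = 0"
  proof
    fix l assume "l \<in> S"
    then show "total_flow A l = 0" using W(3)[THEN spec, of l] B0 unfolding AB(1) by simp
  qed
  have "signed A" using W(2) AB(1) by simp
  from H[OF AB(2) this A0] obtain A' where "map fst A' = L'" "local_lift TYPE('k) S A A'" by blast
  note A' = this(1) this(2)[unfolded local_lift_def this(1) AB(2), THEN conjunct1]
    this(2)[unfolded local_lift_def this(1) AB(2), THEN conjunct2, THEN conjunct1]
    this(2)[unfolded local_lift_def this(1) AB(2), THEN conjunct2, THEN conjunct2]
  have "\<exists>g'. \<forall>x\<in>set (A' @ B). lift f' g' x" if f': "\<forall>v\<in>set (L' @ R). fox f' v" for f' :: "nat \<Rightarrow>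
      'k"
  proof -
    have "\<forall>v\<in>set L'. fox f' v" using f' by simp
    from A'(4)[THEN spec, THEN mp, OF this] obtain f
      where f: "\<forall>l. l \<notin> S \<longrightarrow> f l = f' l" "\<forall>v\<in>set L. fox f v"
        "\<forall>g. (\<forall>x\<in>set A. lift f g x) \<longrightarrow>
               (\<exists>g'. (\<forall>l. l \<notin> S \<longrightarrow> g' l = g l) \<and> (\<forall>x\<in>set A'. lift f' g' x))"
      by (elim exE conjE) (rule that)
    have R: "l \<notin> S" if "v \<in> set R" "l \<in> set_vertex v" for l v
      using S that by auto
    have "fox f v" if "v \<in> set R" for v
    proof -
      have "fox f v = fox f' v"
      proof (rule fox_cong)
        fix l assume "l \<in> set_vertex v"
        then have "l \<notin> S" using R[OF that] by simp
        then show "f l = f' l" using f(1) by simp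
      qed
      then show ?thesis using f' that by simp
    qed
    with f(2) have "\<forall>v\<in>set (L @ R). fox f v" by auto
    from W(4)[OF this] obtain g where g: "\<forall>x\<in>set W. lift f g x" by blast
    then have "\<forall>x\<in>set A. lift f g x" using AB(1) by simp
    from f(3)[THEN spec, THEN mp, OF this] obtain g' where
      g': "\<forall>l. l \<notin> S \<longrightarrow> g' l = g l" "\<forall>x\<in>set A'. lift f' g' x"
      by (elim exE conjE) (rule that)
    have "\<forall>x\<in>set B. lift f' g' x"
    proof
      fix x assume that: "x \<in> set B"
      have "fst x \<in> set R" using that AB(3) by auto
      then have "lift f' g' x = lift f g x"
      proof (intro lift_cong)
        fix l assume "l \<in> set_vertex (fst x)"
        then have "l \<notin> S" using R[OF \<open>fst x \<in> set R\<close>] by simp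
        then show "f' l = f l" "g' l = g l" using f(1) g'(1) by simp_all
      qed
      moreover have "lift f g x" using g that AB(1) by simp
      ultimately show "lift f' g' x" by simp
    qed
    with g'(2) show ?thesis by (intro exI[of _ g']) (simp only: set_append ball_Un simp_thms)
  qed
  moreover have "total_flow (A' @ B) l = 0" for l
  proof (cases "l \<in> S")
    case True
    then show ?thesis using A'(3) B0[of l] by simp
  next
    case False
    then show ?thesis using A'(3) W(3)[THEN spec, of l] AB(1) by simp
  qed
  moreover have "map fst (A' @ B) = L' @ R" "signed (A' @ B)"
    using A'(1,2) AB W(2) by simp_all
  ultimately show ?thesis by (intro liftableI)
qed

section \<open>Occurrences of labels and relabelling\<close>

definition occurrences :: "diagram \<Rightarrow> nat \<Rightarrow> nat" where
  "occurrences D l = (\<Sum>v\<leftarrow>D. count_list (ends v) l)"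

lemma occurrences_simps [simp]:
  "occurrences [] l = 0" "occurrences (v # D) l = count_list (ends v) l + occurrences D l"
  by (simp_all add: occurrences_def)

lemma set_ends: "set (ends v) = set_vertex v"
  by (cases v) auto

lemma occurrences_eq_0_iff: "occurrences D l = 0 \<longleftrightarrow> l \<notin> labels D"
  by (induction D) (auto simp: count_list_0_iff set_ends)

lemma count_list_card: "count_list xs l = card {k. k < length xs \<and> xs ! k = l}"
  by (simp add: count_list_eq_length_filter length_filter_conv_card eq_commute)

lemma finite_darts: "finite (darts D)"
proof -
  have "darts D = (SIGMA i:{..<length D}. {..<length (ends (D ! i))})"
    by (auto simp: darts_def)
  then show ?thesis by simp
qed

lemma occurrences_card: "occurrences D l = card {d \<in> darts D. label D d = l}"
proof -
  have "{d \<in> darts D. label D d = l} =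
      (SIGMA i:{..<length D}. {k. k < length (ends (D ! i)) \<and> ends (D ! i) ! k = l})"
    by (auto simp: darts_def label_def)
  then have "card {d \<in> darts D. label D d = l} =
      (\<Sum>i<length D. card {k. k < length (ends (D ! i)) \<and> ends (D ! i) ! k = l})"
    by simp
  also have "\<dots> = (\<Sum>i<length D. count_list (ends (D ! i)) l)"
    by (simp add: count_list_card)
  also have "\<dots> = occurrences D l"
    by (simp add: occurrences_def sum_list_sum_nth atLeast0LessThan)
  finally show ?thesis ..
qed

lemma label_dart: "l \<in> labels D \<Longrightarrow> \<exists>d\<in>darts D. label D d = l"
proof -
  assume "l \<in> labels D"
  then obtain i where "i < length D" "l \<in> set (ends (D ! i))"
    by (auto simp: set_ends in_set_conv_nth)
  then show ?thesis
    by (force simp: in_set_conv_nth darts_def label_def)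
qed

text \<open>
  An edge that occurs twice inside a tangle therefore occurs nowhere else, which is how the
  inner edges of the moves are recognised.
\<close>

lemma well_labelled_occurrences:
  assumes "well_labelled D" "l \<in> labels D"
  shows "occurrences D l = 2"
proof -
  obtain d where d: "d \<in> darts D" "label D d = l" using label_dart[OF assms(2)] by blast
  with assms(1) obtain d' where d': "d' \<in> darts D" "d' \<noteq> d" "label D d' = l"
    "\<And>e. e \<in> darts D \<Longrightarrow> e \<noteq> d \<Longrightarrow> label D e = l \<Longrightarrow> e = d'"
    unfolding well_labelled_def by metis
  have "{e \<in> darts D. label D e = l} = {d, d'}" using d d' by blast
  then show ?thesis using d'(2) by (simp add: occurrences_card)
qed

lemma well_labelled_occurrences_le: "well_labelled D \<Longrightarrow> occurrences D l \<le> 2"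
  using well_labelled_occurrences[of D l] occurrences_eq_0_iff[of D l] by fastforce

text \<open>The relabelling \<open>h\<close> may identify labels: absorbing a point merges its two edges.\<close>

lemma flow_relabel:
  assumes "finite S" "set_vertex v \<subseteq> S"
  shows "flow (map_vertex h v, s) l = (\<Sum>m\<in>{m\<in>S. h m = l}. flow (v, s) m)"
proof -
  have *: "(\<Sum>m\<in>{m\<in>S. h m = l}. of_bool (m = a)) = (of_bool (l = h a) :: int)" if "a \<in> S" for a
  proof -
    have "(\<Sum>m\<in>{m\<in>S. h m = l}. of_bool (m = a)) = (of_bool (a \<in> {m\<in>S. h m = l}) :: int)"
      using assms(1) by (simp add: of_bool_def sum.delta)
    then show ?thesis using that by auto
  qed
  show ?thesis
    using assms(2)
    by (cases v; cases s)
      (auto simp: sum.distrib sum_subtractf * simp flip: sum_distrib_left)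
qed

abbreviation relabel :: "(nat \<Rightarrow> nat) \<Rightarrow> decorated_vertex list \<Rightarrow> decorated_vertex list" where
  "relabel h \<equiv> map (map_prod (map_vertex h) id)"

lemma total_flow_relabel:
  assumes "finite S" "labels (map fst W) \<subseteq> S"
  shows "total_flow (relabel h W) l = (\<Sum>m\<in>{m\<in>S. h m = l}. total_flow W m)"
  using assms(2)
proof (induction W)
  case Nil
  then show ?case by simp
next
  case (Cons x W)
  obtain v s where x: "x = (v, s)" by (cases x)
  have "set_vertex v \<subseteq> S" "labels (map fst W) \<subseteq> S" using Cons.prems x by auto
  then show ?case
    using Cons.IH flow_relabel[OF assms(1), of v h s l] by (simp add: x sum.distrib)
qed

lemma finite_labels: "finite (labels D)"
proof -
  have "finite (set_vertex v)" for v :: "nat vertex" by (metis List.finite_set set_ends)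
  then show ?thesis by simp
qed

lemma signed_relabel: "signed (relabel h W) \<longleftrightarrow> signed W"
  by (auto simp: signed_def)

lemma map_fst_relabel: "map fst (relabel h W) = map (map_vertex h) (map fst W)"
  by simp

lemma lift_relabel: "lift f g (map_prod (map_vertex h) id x) = lift (f \<circ> h) (g \<circ> h) x"
  by (cases x) (simp add: lift_map del: lift.simps)

lemma balanced_relabel:
  "\<forall>l. total_flow W l = 0 \<Longrightarrow> total_flow (relabel h W) l = 0"
  using total_flow_relabel[OF finite_labels order_refl, of h W l] by simp

lemma liftable_rename:
  assumes inj: "inj_on h (labels D)" and D: "liftable TYPE('k::comm_ring_1) D"
  shows "liftable TYPE('k) (map (map_vertex h) D)"
proof -
  from D obtain W where W: "map fst W = D" "signed W" "\<forall>l. total_flow W l = 0"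
    "\<And>f :: nat \<Rightarrow> 'k. \<forall>v\<in>set D. fox f v \<Longrightarrow> \<exists>g. \<forall>x\<in>set W. lift f g x"
    by (rule liftableE) (rule that)
  have "\<exists>g. \<forall>x\<in>set (relabel h W). lift f g x" if "\<forall>v\<in>set (map (map_vertex h) D). fox f v"
    for f :: "nat \<Rightarrow> 'k"
  proof -
    have "\<forall>v\<in>set D. fox (f \<circ> h) v" using that by (simp add: fox_map)
    from W(4)[OF this] obtain g where g: "\<forall>x\<in>set W. lift (f \<circ> h) g x" ..
    define g' where "g' = g \<circ> inv_into (labels D) h"
    have "lift f g' (map_prod (map_vertex h) id x)" if x: "x \<in> set W" for x
    proof -
      have "fst x \<in> set D" using x W(1) by auto
      have "lift (f \<circ> h) (g' \<circ> h) x = lift (f \<circ> h) g x"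
      proof (rule lift_cong)
        fix l assume "l \<in> set_vertex (fst x)"
        then have "l \<in> labels D" using \<open>fst x \<in> set D\<close> by blast
        then show "(g' \<circ> h) l = g l" using inj by (simp add: g'_def)
      qed simp
      then show ?thesis using g x by (simp add: lift_relabel)
    qed
    then show ?thesis by (intro exI[of _ g']) simp
  qed
  moreover have "map fst (relabel h W) = map (map_vertex h) D" "signed (relabel h W)"
    using W(1,2) by (simp_all only: map_fst_relabel signed_relabel)
  ultimately show ?thesis using balanced_relabel[OF W(3)] by (intro liftableI)
qed

lemma liftable_rename_iff:
  assumes inj: "inj_on h (labels D)"
  shows "liftable TYPE('k::comm_ring_1) (map (map_vertex h) D) \<longleftrightarrow> liftable TYPE('k) D"
proof
  let ?i = "inv_into (labels D) h"
  have labs: "labels (map (map_vertex h) D) = h ` labels D"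
    by (auto simp: vertex.set_map)
  have "map (map_vertex ?i) (map (map_vertex h) D) = map id D"
    unfolding map_map
  proof (rule map_cong)
    fix v assume v: "v \<in> set D"
    have "map_vertex (?i \<circ> h) v = map_vertex id v"
    proof (rule vertex.map_cong)
      fix l assume "l \<in> set_vertex v"
      then have "l \<in> labels D" using v by blast
      then show "(?i \<circ> h) l = id l" using inj by simp
    qed simp
    then show "(map_vertex ?i \<circ> map_vertex h) v = id v"
      by (simp add: vertex.map_comp vertex.map_id)
  qed simp
  then have D: "map (map_vertex ?i) (map (map_vertex h) D) = D" by simp
  assume "liftable TYPE('k) (map (map_vertex h) D)"
  moreover have "inj_on ?i (labels (map (map_vertex h) D))"
    unfolding labs by (rule inj_on_inv_into) simp
  ultimately show "liftable TYPE('k) D"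
    using liftable_rename[of ?i "map (map_vertex h) D"] D by simp
qed (rule liftable_rename[OF inj])

text \<open>
  Size and parity: an edge that occurs once in a list of vertices has total flow \<open>1\<close> or \<open>- 1\<close>
  there. This provides the sign of a point that is inserted into an edge.
\<close>

lemma flow_bound:
  assumes "\<bar>u\<bar> = 1" "\<bar>w\<bar> = 1"
  shows "\<bar>flow (v, u, w) l\<bar> \<le> int (count_list (ends v) l) \<and>
    even (flow (v, u, w) l - int (count_list (ends v) l))"
  using assms by (cases v) (auto simp: abs_if split: if_splits)

lemma total_flow_bound:
  "signed W \<Longrightarrow> \<bar>total_flow W l\<bar> \<le> int (occurrences (map fst W) l) \<and>
    even (total_flow W l - int (occurrences (map fst W) l))"
proof (induction W)
  case (Cons x W)
  obtain v u w where x: "x = (v, u, w)" by (cases x)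
  have "\<bar>u\<bar> = 1" "\<bar>w\<bar> = 1" "signed W" using Cons.prems by (auto simp: x)
  from flow_bound[OF this(1,2), of v l] Cons.IH[OF this(3)] show ?case
    by (simp add: x) presburger
qed simp

text \<open>
  From right to left, the edge \<open>a\<close> is cut by a point. The rest of the diagram keeps its signs,
  and the sign \<open>u\<close> of the point is forced by the flow of the new edge \<open>b\<close>.
\<close>

lemma liftable_absorb_iff:
  assumes "a \<noteq> b" "well_labelled (Point a b # D)"
  shows "liftable TYPE('k::comm_ring_1) (Point a b # D) \<longleftrightarrow>
    liftable TYPE('k) (map (map_vertex (id(b := a))) D)"
proof
  let ?h = "id(b := a)"
  have occ: "occurrences D b = 1"
    using well_labelled_occurrences[OF assms(2), of b] assms(1) by simp
  {
    assume "liftable TYPE('k) (Point a b # D)"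
    then obtain W0 where W0: "map fst W0 = Point a b # D" "signed W0" "\<forall>l. total_flow W0 l = 0"
      "\<And>f :: nat \<Rightarrow> 'k. \<forall>v\<in>set (Point a b # D). fox f v \<Longrightarrow> \<exists>g. \<forall>x\<in>set W0. lift f g x"
      by (rule liftableE) (rule that)
    from W0(1) obtain u w W where W: "W0 = (Point a b, u, w) # W" "map fst W = D"
      by (auto simp: map_eq_Cons_conv)
    have "total_flow (relabel ?h W) l = 0" for l
      using balanced_relabel[OF W0(3), of ?h l] assms(1) by (simp add: W(1))
    moreover have "\<exists>g. \<forall>x\<in>set (relabel ?h W). lift f g x"
      if "\<forall>v\<in>set (map (map_vertex ?h) D). fox f v" for f :: "nat \<Rightarrow> 'k"
    proof -
      have "\<forall>v\<in>set (Point a b # D). fox (f \<circ> ?h) v" using that assms(1) by (simp add: fox_map)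
      from W0(4)[OF this] obtain g
        where g: "\<forall>x\<in>set W0. lift (f \<circ> ?h) g x" ..
      have "g a = g b" using g by (simp add: W(1))
      then have "g \<circ> ?h = g" by auto
      then show ?thesis using g by (intro exI[of _ g]) (simp add: lift_relabel W(1))
    qed
    moreover have "map fst (relabel ?h W) = map (map_vertex ?h) D" "signed (relabel ?h W)"
      using W W0(2) by (simp_all only: map_fst_relabel signed_relabel signed_simps)
    ultimately show "liftable TYPE('k) (map (map_vertex ?h) D)" by (intro liftableI)
  }
  {
    assume "liftable TYPE('k) (map (map_vertex ?h) D)"
    then obtain W' where W': "map fst W' = map (map_vertex ?h) D"
      "signed W'" "\<forall>l. total_flow W' l = 0"
      "\<And>f :: nat \<Rightarrow> 'k. \<forall>v\<in>set (map (map_vertex ?h) D). fox f v \<Longrightarrow>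
        \<exists>g. \<forall>x\<in>set W'. lift f g x"
      by (rule liftableE) (rule that)
    define W where "W = zip D (map snd W')"
    have len: "length W' = length D" using W'(1) by (metis length_map)
    have W: "map fst W = D" using len by (simp add: W_def)
    have rel: "relabel ?h W = W'"
    proof (rule nth_equalityI)
      fix i assume i: "i < length (relabel ?h W)"
      then have "fst (W' ! i) = map_vertex ?h (D ! i)"
        using arg_cong[OF W'(1), of "\<lambda>L. L ! i"] len by (simp add: W_def)
      then show "relabel ?h W ! i = W' ! i" using i len by (simp add: W_def prod_eq_iff)
    qed (simp add: W_def len)
    have signed: "signed W" using W'(2) signed_relabel[of ?h W] by (simp add: rel)
    let ?S = "insert a (insert b (labels D))"
    have tf: "total_flow W' l = (\<Sum>m\<in>{m\<in>?S. ?h m = l}. total_flow W m)" for l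
    proof -
      have "finite ?S" "labels (map fst W) \<subseteq> ?S"
        using finite_labels[of D] unfolding W by blast+
      from total_flow_relabel[OF this, of ?h l] show ?thesis unfolding rel .
    qed
    define u where "u = - total_flow W b"
    have u: "u \<in> {1, - 1}"
      using total_flow_bound[OF signed, of b] occ by (simp add: W u_def) presburger
    have "{m\<in>?S. ?h m = a} = {a, b}" using assms(1) by auto
    then have ab: "total_flow W a + total_flow W b = 0"
      using tf[of a] W'(3) assms(1) by simp
    have other: "total_flow W l = 0" if "l \<noteq> a" "l \<noteq> b" for l
    proof (cases "l \<in> labels D")
      case True
      then have "{m\<in>?S. ?h m = l} = {l}" using that by auto
      then show ?thesis using tf[of l] W'(3) by simp
    next
      case False
      then show ?thesis by (intro total_flow_outside) (simp add: W)
    qed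
    have "total_flow ((Point a b, u, 1) # W) l = 0" for l
      using ab other[of l] assms(1) by (auto simp: u_def)
    moreover have "\<exists>g. \<forall>x\<in>set ((Point a b, u, 1) # W). lift f g x"
      if f: "\<forall>v\<in>set (Point a b # D). fox f v" for f :: "nat \<Rightarrow> 'k"
    proof -
      have fh: "f \<circ> ?h = f" using f by auto
      then have "\<forall>v\<in>set (map (map_vertex ?h) D). fox f v" using f by (simp add: fox_map)
      from W'(4)[OF this] obtain g where g: "\<forall>x\<in>set W'. lift f g x" ..
      then have "\<forall>x\<in>set W. lift (f \<circ> ?h) (g \<circ> ?h) x"
        unfolding rel[symmetric] by (simp add: lift_relabel)
      then show ?thesis using assms(1) by (intro exI[of _ "g \<circ> ?h"]) (simp add: fh)
    qed
    moreover have "map fst ((Point a b, u, 1) # W) = Point a b # D" "signed ((Point a b, u, 1) #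
        W)"
      using W u signed by simp_all
    ultimately show "liftable TYPE('k) (Point a b # D)" by (intro liftableI)
  }
qed

section \<open>Local Reidemeister moves\<close>

lemma fresh_labels:
  assumes "well_labelled (L @ R)" "\<forall>x\<in>S. 2 \<le> occurrences L x"
  shows "S \<inter> labels R = {}"
proof -
  have "occurrences R x = 0" if "x \<in> S" for x
  proof -
    have "occurrences L x + occurrences R x \<le> 2"
      using well_labelled_occurrences_le[OF assms(1), of x] by (simp add: occurrences_def)
    then show ?thesis using assms(2) that by fastforce
  qed
  then show ?thesis by (auto simp only: occurrences_eq_0_iff)
qed

text \<open>
  The tangles of a move contain up to nine edges, and the facts that inner edges differ from the
  others would make linear arithmetic split into exponentially many cases; the limit prevents
  this.

  For each move, \<open>values_forward\<close> and \<open>values_backward\<close> contain the algebra: the values that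
  colourings and lifts have to take on the inner edges, and the fact that these satisfy all
  equations of the other side. The flow through the inner edges shows which strands of a
  decoration have equal signs.
\<close>

context
  notes [[linarith_neq_limit = 1]]
begin

lemma count_list_Cons: "count_list (y # ys) x = of_bool (y = x) + count_list ys x"
  by simp

lemma self_reflection: "p = 2 * p - q \<longleftrightarrow> p = q" "2 * p - p = p" for p q :: "'k::comm_ring_1"
  unfolding mult_2 eq_diff_eq add_left_cancel by (rule eq_commute, rule add_diff_cancel_left')

lemmas colouring_simps = list.map list.set fst_conv ball_simps fox.simps lift.simps fun_upd_apply
  simp_thms if_True if_False

lemma liftable_local_iff:
  assumes "S \<inter> labels R = {}"
    and "\<And>W. \<lbrakk>map fst W = L; signed W; \<forall>l\<in>S. total_flow W l = 0\<rbrakk> \<Longrightarrow>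
      \<exists>W'. map fst W' = L' \<and> local_lift TYPE('k::comm_ring_1) S W W'"
    and "\<And>W. \<lbrakk>map fst W = L'; signed W; \<forall>l\<in>S. total_flow W l = 0\<rbrakk> \<Longrightarrow>
      \<exists>W'. map fst W' = L \<and> local_lift TYPE('k) S W W'"
  shows "liftable TYPE('k) (L @ R) \<longleftrightarrow> liftable TYPE('k) (L' @ R)"
  using liftable_local[OF assms(1,2)] liftable_local[OF assms(1,3)] by blast

lemma turn_crossing_values_forward:
  fixes fa fb fc fd ga gb gc gd :: "'k::comm_ring_1"
  assumes "fox_at fc fd fa fb"
  shows "fox_at fa fb fc fd"
    "lift_at w fb fc ga gb gc gd \<Longrightarrow>
     lift_at (- w) fd fa gc gd ga gb"
  using assms unfolding fox_at_def lift_at_def by (clarify, simp add: algebra_simps)+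

lemma turn_crossing_values_backward:
  fixes fa fb fc fd ga gb gc gd :: "'k::comm_ring_1"
  assumes "fox_at fa fb fc fd"
  shows "fox_at fc fd fa fb"
    "lift_at w fd fa gc gd ga gb \<Longrightarrow>
     lift_at (- w) fb fc ga gb gc gd"
  using assms unfolding fox_at_def lift_at_def by (clarify, simp add: algebra_simps)+

lemma liftable_turn_crossing_iff:
  "liftable TYPE('k::comm_ring_1) (Crossing a b c d # R) \<longleftrightarrow>
    liftable TYPE('k) (Crossing c d a b # R)"
proof -
  let ?L = "[Crossing a b c d]" and ?L' = "[Crossing c d a b]"
  have "liftable TYPE('k) (?L @ R) \<longleftrightarrow> liftable TYPE('k) (?L' @ R)"
  proof (rule liftable_local_iff[of "{}" R ?L ?L'])
    fix W assume W: "map fst W = ?L" "signed W" "\<forall>l\<in>{}. total_flow W l = 0"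
    from W(1) obtain u1 w1 where W': "W = [(Crossing a b c d, u1, w1)]"
      by (auto simp: map_eq_Cons_conv)
    let ?W = "[(Crossing a b c d, u1, w1)]"
    let ?W' = "[(Crossing c d a b, - u1, - w1)]"
    let ?F = "\<lambda>f :: nat \<Rightarrow> 'k. f"
    let ?G = "\<lambda>f g :: nat \<Rightarrow> 'k. g"
    have "local_lift TYPE('k) {} ?W ?W'"
    proof (rule local_liftI[where F = ?F and G = ?G])
      show "signed ?W'" using W(2) unfolding W' by (auto simp: signed_def)
      show "total_flow ?W' l = (if l \<in> {} then 0 else total_flow ?W l)" for l
        by (simp add: algebra_simps)
    next
      fix f g :: "nat \<Rightarrow> 'k"
      assume f: "\<forall>v\<in>set (map fst ?W'). fox f v"
      then show "\<forall>v\<in>set (map fst ?W). fox (?F f) v"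
        by (simp (no_asm_use) only: colouring_simps) (rule turn_crossing_values_forward(1))
      assume "\<forall>t\<in>set ?W. lift (?F f) g t"
      with f show "\<forall>t\<in>set ?W'. lift f (?G f g) t"
        by (simp (no_asm_use) only: colouring_simps) (rule turn_crossing_values_forward(2))
    qed simp_all
    then show "\<exists>W'. map fst W' = ?L' \<and> local_lift TYPE('k) {} W W'"
      unfolding W' by (intro exI[of _ ?W'] conjI) simp_all
  next
    fix W assume W: "map fst W = ?L'" "signed W" "\<forall>l\<in>{}. total_flow W l = 0"
    from W(1) obtain u1 w1 where W': "W = [(Crossing c d a b, u1, w1)]"
      by (auto simp: map_eq_Cons_conv)
    let ?W = "[(Crossing c d a b, u1, w1)]"
    let ?W' = "[(Crossing a b c d, - u1, - w1)]"
    let ?F = "\<lambda>f :: nat \<Rightarrow> 'k. f"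
    let ?G = "\<lambda>f g :: nat \<Rightarrow> 'k. g"
    have "local_lift TYPE('k) {} ?W ?W'"
    proof (rule local_liftI[where F = ?F and G = ?G])
      show "signed ?W'" using W(2) unfolding W' by (auto simp: signed_def)
      show "total_flow ?W' l = (if l \<in> {} then 0 else total_flow ?W l)" for l
        by (simp add: algebra_simps)
    next
      fix f g :: "nat \<Rightarrow> 'k"
      assume f: "\<forall>v\<in>set (map fst ?W'). fox f v"
      then show "\<forall>v\<in>set (map fst ?W). fox (?F f) v"
        by (simp (no_asm_use) only: colouring_simps) (rule turn_crossing_values_backward(1))
      assume "\<forall>t\<in>set ?W. lift (?F f) g t"
      with f show "\<forall>t\<in>set ?W'. lift f (?G f g) t"
        by (simp (no_asm_use) only: colouring_simps) (rule turn_crossing_values_backward(2))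
    qed simp_all
    then show "\<exists>W'. map fst W' = ?L \<and> local_lift TYPE('k) {} W W'"
      unfolding W' by (intro exI[of _ ?W'] conjI) simp_all
  qed simp
  then show ?thesis by simp
qed

lemma turn_point_values_forward:
  fixes fa fb ga gb :: "'k::comm_ring_1"
  assumes "fb = fa"
  shows "fa = fb"
    "ga = gb \<Longrightarrow>
     gb = ga"
  using assms unfolding fox_at_def lift_at_def by (clarify, simp add: algebra_simps)+

lemma turn_point_values_backward:
  fixes fa fb ga gb :: "'k::comm_ring_1"
  assumes "fa = fb"
  shows "fb = fa"
    "gb = ga \<Longrightarrow>
     ga = gb"
  using assms unfolding fox_at_def lift_at_def by (clarify, simp add: algebra_simps)+

lemma liftable_turn_point_iff:
  "liftable TYPE('k::comm_ring_1) (Point a b # R) \<longleftrightarrow>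
    liftable TYPE('k) (Point b a # R)"
proof -
  let ?L = "[Point a b]" and ?L' = "[Point b a]"
  have "liftable TYPE('k) (?L @ R) \<longleftrightarrow> liftable TYPE('k) (?L' @ R)"
  proof (rule liftable_local_iff[of "{}" R ?L ?L'])
    fix W assume W: "map fst W = ?L" "signed W" "\<forall>l\<in>{}. total_flow W l = 0"
    from W(1) obtain u1 w1 where W': "W = [(Point a b, u1, w1)]"
      by (auto simp: map_eq_Cons_conv)
    let ?W = "[(Point a b, u1, w1)]"
    let ?W' = "[(Point b a, - u1, w1)]"
    let ?F = "\<lambda>f :: nat \<Rightarrow> 'k. f"
    let ?G = "\<lambda>f g :: nat \<Rightarrow> 'k. g"
    have "local_lift TYPE('k) {} ?W ?W'"
    proof (rule local_liftI[where F = ?F and G = ?G])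
      show "signed ?W'" using W(2) unfolding W' by (auto simp: signed_def)
      show "total_flow ?W' l = (if l \<in> {} then 0 else total_flow ?W l)" for l
        by (simp add: algebra_simps)
    next
      fix f g :: "nat \<Rightarrow> 'k"
      assume f: "\<forall>v\<in>set (map fst ?W'). fox f v"
      then show "\<forall>v\<in>set (map fst ?W). fox (?F f) v"
        by (simp (no_asm_use) only: colouring_simps) (rule turn_point_values_forward(1))
      assume "\<forall>t\<in>set ?W. lift (?F f) g t"
      with f show "\<forall>t\<in>set ?W'. lift f (?G f g) t"
        by (simp (no_asm_use) only: colouring_simps) (rule turn_point_values_forward(2))
    qed simp_all
    then show "\<exists>W'. map fst W' = ?L' \<and> local_lift TYPE('k) {} W W'"
      unfolding W' by (intro exI[of _ ?W'] conjI) simp_all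
  next
    fix W assume W: "map fst W = ?L'" "signed W" "\<forall>l\<in>{}. total_flow W l = 0"
    from W(1) obtain u1 w1 where W': "W = [(Point b a, u1, w1)]"
      by (auto simp: map_eq_Cons_conv)
    let ?W = "[(Point b a, u1, w1)]"
    let ?W' = "[(Point a b, - u1, w1)]"
    let ?F = "\<lambda>f :: nat \<Rightarrow> 'k. f"
    let ?G = "\<lambda>f g :: nat \<Rightarrow> 'k. g"
    have "local_lift TYPE('k) {} ?W ?W'"
    proof (rule local_liftI[where F = ?F and G = ?G])
      show "signed ?W'" using W(2) unfolding W' by (auto simp: signed_def)
      show "total_flow ?W' l = (if l \<in> {} then 0 else total_flow ?W l)" for l
        by (simp add: algebra_simps)
    next
      fix f g :: "nat \<Rightarrow> 'k"
      assume f: "\<forall>v\<in>set (map fst ?W'). fox f v"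
      then show "\<forall>v\<in>set (map fst ?W). fox (?F f) v"
        by (simp (no_asm_use) only: colouring_simps) (rule turn_point_values_backward(1))
      assume "\<forall>t\<in>set ?W. lift (?F f) g t"
      with f show "\<forall>t\<in>set ?W'. lift f (?G f g) t"
        by (simp (no_asm_use) only: colouring_simps) (rule turn_point_values_backward(2))
    qed simp_all
    then show "\<exists>W'. map fst W' = ?L \<and> local_lift TYPE('k) {} W W'"
      unfolding W' by (intro exI[of _ ?W'] conjI) simp_all
  qed simp
  then show ?thesis by simp
qed

lemma R1a_values_forward:
  fixes fa fb fx ga gb gx :: "'k::comm_ring_1"
  assumes "fa = fb"
  shows "fox_at fa fa fa fb"
    "lift_at u fa fa ga gx gx gb \<Longrightarrow>
     ga = gb"
  using assms unfolding fox_at_def lift_at_def by (auto simp: self_reflection)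

lemma R1a_values_backward:
  fixes fa fb fx ga gb gx :: "'k::comm_ring_1"
  assumes "fox_at fa fx fx fb"
  shows "fa = fb"
    "ga = gb \<Longrightarrow>
     lift_at u fx fx ga ga ga gb"
  using assms unfolding fox_at_def lift_at_def by (auto simp: self_reflection)

lemma liftable_R1a_iff:
  assumes "well_labelled (Crossing a x x b # R)"
  shows "liftable TYPE('k::comm_ring_1) (Crossing a x x b # R) \<longleftrightarrow>
    liftable TYPE('k) (Point a b # R)"
proof -
  have d: "x \<noteq> a" "x \<noteq> b"
    using well_labelled_occurrences_le[OF assms, of x]
    by (intro notI; simp add: count_list_Cons del: count_list.simps(2))+
  have S: "{x} \<inter> labels R = {}"
    using fresh_labels[of "[Crossing a x x b]" R "{x}"] assms d by simp
  let ?L = "[Crossing a x x b]" and ?L' = "[Point a b]"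
  have "liftable TYPE('k) (?L @ R) \<longleftrightarrow> liftable TYPE('k) (?L' @ R)"
  proof (rule liftable_local_iff[of "{x}" R ?L ?L'])
    fix W assume W: "map fst W = ?L" "signed W" "\<forall>l\<in>{x}. total_flow W l = 0"
    from W(1) obtain u1 w1 where W': "W = [(Crossing a x x b, u1, w1)]"
      by (auto simp: map_eq_Cons_conv)
    have e: "w1 = u1"
    proof -
      have "total_flow W x = u1 - w1"
        using d by (simp_all add: W')
      moreover have "total_flow W x = 0"
        using W(3) by simp_all
      ultimately show "w1 = u1"
        by - linarith+
    qed
    let ?W = "[(Crossing a x x b, u1, u1)]"
    let ?W' = "[(Point a b, u1, 1)]"
    let ?F = "\<lambda>f :: nat \<Rightarrow> 'k. f(x := f a)"
    let ?G = "\<lambda>f g :: nat \<Rightarrow> 'k. g"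
    have "local_lift TYPE('k) {x} ?W ?W'"
    proof (rule local_liftI[where F = ?F and G = ?G])
      show "signed ?W'" using W(2) unfolding W' by (auto simp: signed_def)
      show "total_flow ?W' l = (if l \<in> {x} then 0 else total_flow ?W l)" for l
        using d by (cases "l = x"; simp add: algebra_simps)
    next
      fix f g :: "nat \<Rightarrow> 'k"
      assume f: "\<forall>v\<in>set (map fst ?W'). fox f v"
      then show "\<forall>v\<in>set (map fst ?W). fox (?F f) v"
        by (simp (no_asm_use) only: colouring_simps d d[symmetric]) (rule R1a_values_forward(1))
      assume "\<forall>t\<in>set ?W. lift (?F f) g t"
      with f show "\<forall>t\<in>set ?W'. lift f (?G f g) t"
        by (simp (no_asm_use) only: colouring_simps d d[symmetric]) (rule R1a_values_forward(2))
    qed simp_all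
    then show "\<exists>W'. map fst W' = ?L' \<and> local_lift TYPE('k) {x} W W'"
      unfolding W' e by (intro exI[of _ ?W'] conjI) simp_all
  next
    fix W assume W: "map fst W = ?L'" "signed W" "\<forall>l\<in>{x}. total_flow W l = 0"
    from W(1) obtain u1 w1 where W': "W = [(Point a b, u1, w1)]"
      by (auto simp: map_eq_Cons_conv)
    let ?W = "[(Point a b, u1, w1)]"
    let ?W' = "[(Crossing a x x b, u1, u1)]"
    let ?F = "\<lambda>f :: nat \<Rightarrow> 'k. f"
    let ?G = "\<lambda>f g :: nat \<Rightarrow> 'k. g(x := g a)"
    have "local_lift TYPE('k) {x} ?W ?W'"
    proof (rule local_liftI[where F = ?F and G = ?G])
      show "signed ?W'" using W(2) unfolding W' by (auto simp: signed_def)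
      show "total_flow ?W' l = (if l \<in> {x} then 0 else total_flow ?W l)" for l
        using d by (cases "l = x"; simp add: algebra_simps)
    next
      fix f g :: "nat \<Rightarrow> 'k"
      assume f: "\<forall>v\<in>set (map fst ?W'). fox f v"
      then show "\<forall>v\<in>set (map fst ?W). fox (?F f) v"
        by (simp (no_asm_use) only: colouring_simps d d[symmetric]) (rule R1a_values_backward(1))
      assume "\<forall>t\<in>set ?W. lift (?F f) g t"
      with f show "\<forall>t\<in>set ?W'. lift f (?G f g) t"
        by (simp (no_asm_use) only: colouring_simps d d[symmetric]) (rule R1a_values_backward(2))
    qed simp_all
    then show "\<exists>W'. map fst W' = ?L \<and> local_lift TYPE('k) {x} W W'"
      unfolding W' by (intro exI[of _ ?W'] conjI) simp_all
  qed (rule S)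
  then show ?thesis by simp
qed

lemma R1b_values_forward:
  fixes fa fb fx ga gb gx :: "'k::comm_ring_1"
  assumes "fa = fb"
  shows "fox_at fa fa fb fa"
    "lift_at w fa fb gx gx gb ga \<Longrightarrow>
     ga = gb"
  using assms unfolding fox_at_def lift_at_def by (auto simp: self_reflection)

lemma R1b_values_backward:
  fixes fa fb fx ga gb gx :: "'k::comm_ring_1"
  assumes "fox_at fx fx fb fa"
  shows "fa = fb"
    "ga = gb \<Longrightarrow>
     lift_at (- u) fx fb ga ga gb ga"
  using assms unfolding fox_at_def lift_at_def by (auto simp: self_reflection)

lemma liftable_R1b_iff:
  assumes "well_labelled (Crossing x x b a # R)"
  shows "liftable TYPE('k::comm_ring_1) (Crossing x x b a # R) \<longleftrightarrow>
    liftable TYPE('k) (Point a b # R)"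
proof -
  have d: "x \<noteq> a" "x \<noteq> b"
    using well_labelled_occurrences_le[OF assms, of x]
    by (intro notI; simp add: count_list_Cons del: count_list.simps(2))+
  have S: "{x} \<inter> labels R = {}"
    using fresh_labels[of "[Crossing x x b a]" R "{x}"] assms d by simp
  let ?L = "[Crossing x x b a]" and ?L' = "[Point a b]"
  have "liftable TYPE('k) (?L @ R) \<longleftrightarrow> liftable TYPE('k) (?L' @ R)"
  proof (rule liftable_local_iff[of "{x}" R ?L ?L'])
    fix W assume W: "map fst W = ?L" "signed W" "\<forall>l\<in>{x}. total_flow W l = 0"
    from W(1) obtain u1 w1 where W': "W = [(Crossing x x b a, u1, w1)]"
      by (auto simp: map_eq_Cons_conv)
    have e: "u1 = - w1"
    proof -
      have "total_flow W x = - u1 - w1"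
        using d by (simp_all add: W')
      moreover have "total_flow W x = 0"
        using W(3) by simp_all
      ultimately show "u1 = - w1"
        by - linarith+
    qed
    let ?W = "[(Crossing x x b a, - w1, w1)]"
    let ?W' = "[(Point a b, - w1, 1)]"
    let ?F = "\<lambda>f :: nat \<Rightarrow> 'k. f(x := f a)"
    let ?G = "\<lambda>f g :: nat \<Rightarrow> 'k. g"
    have "local_lift TYPE('k) {x} ?W ?W'"
    proof (rule local_liftI[where F = ?F and G = ?G])
      show "signed ?W'" using W(2) unfolding W' by (auto simp: signed_def)
      show "total_flow ?W' l = (if l \<in> {x} then 0 else total_flow ?W l)" for l
        using d by (cases "l = x"; simp add: algebra_simps)
    next
      fix f g :: "nat \<Rightarrow> 'k"
      assume f: "\<forall>v\<in>set (map fst ?W'). fox f v"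
      then show "\<forall>v\<in>set (map fst ?W). fox (?F f) v"
        by (simp (no_asm_use) only: colouring_simps d d[symmetric]) (rule R1b_values_forward(1))
      assume "\<forall>t\<in>set ?W. lift (?F f) g t"
      with f show "\<forall>t\<in>set ?W'. lift f (?G f g) t"
        by (simp (no_asm_use) only: colouring_simps d d[symmetric]) (rule R1b_values_forward(2))
    qed simp_all
    then show "\<exists>W'. map fst W' = ?L' \<and> local_lift TYPE('k) {x} W W'"
      unfolding W' e by (intro exI[of _ ?W'] conjI) simp_all
  next
    fix W assume W: "map fst W = ?L'" "signed W" "\<forall>l\<in>{x}. total_flow W l = 0"
    from W(1) obtain u1 w1 where W': "W = [(Point a b, u1, w1)]"
      by (auto simp: map_eq_Cons_conv)
    let ?W = "[(Point a b, u1, w1)]"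
    let ?W' = "[(Crossing x x b a, u1, - u1)]"
    let ?F = "\<lambda>f :: nat \<Rightarrow> 'k. f"
    let ?G = "\<lambda>f g :: nat \<Rightarrow> 'k. g(x := g a)"
    have "local_lift TYPE('k) {x} ?W ?W'"
    proof (rule local_liftI[where F = ?F and G = ?G])
      show "signed ?W'" using W(2) unfolding W' by (auto simp: signed_def)
      show "total_flow ?W' l = (if l \<in> {x} then 0 else total_flow ?W l)" for l
        using d by (cases "l = x"; simp add: algebra_simps)
    next
      fix f g :: "nat \<Rightarrow> 'k"
      assume f: "\<forall>v\<in>set (map fst ?W'). fox f v"
      then show "\<forall>v\<in>set (map fst ?W). fox (?F f) v"
        by (simp (no_asm_use) only: colouring_simps d d[symmetric]) (rule R1b_values_backward(1))
      assume "\<forall>t\<in>set ?W. lift (?F f) g t"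
      with f show "\<forall>t\<in>set ?W'. lift f (?G f g) t"
        by (simp (no_asm_use) only: colouring_simps d d[symmetric]) (rule R1b_values_backward(2))
    qed simp_all
    then show "\<exists>W'. map fst W' = ?L \<and> local_lift TYPE('k) {x} W W'"
      unfolding W' by (intro exI[of _ ?W'] conjI) simp_all
  qed (rule S)
  then show ?thesis by simp
qed

lemma R2_values_forward:
  fixes fa fb fc fd fx fy ga gb gc gd gx gy :: "'k::comm_ring_1"
  assumes "fa = fc \<and> fb = fd"
  shows "fox_at fa fb (2 * fb - fa) fb \<and> fox_at (2 * fb - fa) fd fc fb"
    "lift_at v fb (2 * fb - fa) ga gb gx gy \<and> lift_at (- v) fd fc gx gd gc gy \<Longrightarrow>
     ga = gc \<and> gb = gd"
  using assms unfolding fox_at_def lift_at_def by (clarify, simp add: algebra_simps)+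

lemma R2_values_backward:
  fixes fa fb fc fd fx fy ga gb gc gd gx gy :: "'k::comm_ring_1"
  assumes "fox_at fa fb fx fy \<and> fox_at fx fd fc fy"
  shows "fa = fc \<and> fb = fd"
    "ga = gc \<and> gb = gd \<Longrightarrow>
     lift_at v fb fx ga gb (2 * gb - ga + of_int v * 2 * (fx - fb)) gb \<and> lift_at (- v) fd fc (2 *
         gb - ga + of_int v * 2 * (fx - fb)) gd gc gb"
  using assms unfolding fox_at_def lift_at_def by (clarify, simp add: algebra_simps)+

lemma liftable_R2_iff:
  assumes "well_labelled (Crossing a b x y # Crossing x d c y # R)"
  shows "liftable TYPE('k::comm_ring_1) (Crossing a b x y # Crossing x d c y # R) \<longleftrightarrow>
    liftable TYPE('k) (Point a c # Point b d # R)"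
proof -
  have d: "x \<noteq> y" "x \<noteq> a" "x \<noteq> b" "x \<noteq> c" "x \<noteq> d" "y \<noteq> a" "y \<noteq> b" "y \<noteq> c" "y \<noteq> d"
    using well_labelled_occurrences_le[OF assms, of x] well_labelled_occurrences_le[OF assms, of
        y]
    by (intro notI; simp add: count_list_Cons del: count_list.simps(2))+
  have S: "{x, y} \<inter> labels R = {}"
    using fresh_labels[of "[Crossing a b x y, Crossing x d c y]" R "{x, y}"] assms d by simp
  let ?L = "[Crossing a b x y, Crossing x d c y]" and ?L' = "[Point a c, Point b d]"
  have "liftable TYPE('k) (?L @ R) \<longleftrightarrow> liftable TYPE('k) (?L' @ R)"
  proof (rule liftable_local_iff[of "{x, y}" R ?L ?L'])
    fix W assume W: "map fst W = ?L" "signed W" "\<forall>l\<in>{x, y}. total_flow W l = 0"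
    from W(1) obtain u1 w1 u2 w2 where W': "W = [(Crossing a b x y, u1, w1), (Crossing x d c y,
        u2, w2)]"
      by (auto simp: map_eq_Cons_conv)
    have e: "u2 = u1" "w2 = - w1"
    proof -
      have "total_flow W x = u1 - u2" "total_flow W y = w1 + w2"
        using d by (simp_all add: W')
      moreover have "total_flow W x = 0" "total_flow W y = 0"
        using W(3) by simp_all
      ultimately show "u2 = u1" "w2 = - w1"
        by - linarith+
    qed
    let ?W = "[(Crossing a b x y, u1, w1), (Crossing x d c y, u1, - w1)]"
    let ?W' = "[(Point a c, u1, 1), (Point b d, w1, 1)]"
    let ?F = "\<lambda>f :: nat \<Rightarrow> 'k. f(x := 2 * f b - f a, y := f b)"
    let ?G = "\<lambda>f g :: nat \<Rightarrow> 'k. g"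
    have "local_lift TYPE('k) {x, y} ?W ?W'"
    proof (rule local_liftI[where F = ?F and G = ?G])
      show "signed ?W'" using W(2) unfolding W' by (auto simp: signed_def)
      show "total_flow ?W' l = (if l \<in> {x, y} then 0 else total_flow ?W l)" for l
        using d by (cases "l = x"; cases "l = y"; simp add: algebra_simps)
    next
      fix f g :: "nat \<Rightarrow> 'k"
      assume f: "\<forall>v\<in>set (map fst ?W'). fox f v"
      then show "\<forall>v\<in>set (map fst ?W). fox (?F f) v"
        by (simp (no_asm_use) only: colouring_simps d d[symmetric]) (rule R2_values_forward(1))
      assume "\<forall>t\<in>set ?W. lift (?F f) g t"
      with f show "\<forall>t\<in>set ?W'. lift f (?G f g) t"
        by (simp (no_asm_use) only: colouring_simps d d[symmetric]) (rule R2_values_forward(2))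
    qed simp_all
    then show "\<exists>W'. map fst W' = ?L' \<and> local_lift TYPE('k) {x, y} W W'"
      unfolding W' e by (intro exI[of _ ?W'] conjI) simp_all
  next
    fix W assume W: "map fst W = ?L'" "signed W" "\<forall>l\<in>{x, y}. total_flow W l = 0"
    from W(1) obtain u1 w1 u2 w2 where W': "W = [(Point a c, u1, w1), (Point b d, u2, w2)]"
      by (auto simp: map_eq_Cons_conv)
    let ?W = "[(Point a c, u1, w1), (Point b d, u2, w2)]"
    let ?W' = "[(Crossing a b x y, u1, u2), (Crossing x d c y, u1, - u2)]"
    let ?F = "\<lambda>f :: nat \<Rightarrow> 'k. f"
    let ?G = "\<lambda>f g :: nat \<Rightarrow> 'k. g(x := 2 * g b - g a + of_int u2 * 2 * (f x - f b), y := g b)"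
    have "local_lift TYPE('k) {x, y} ?W ?W'"
    proof (rule local_liftI[where F = ?F and G = ?G])
      show "signed ?W'" using W(2) unfolding W' by (auto simp: signed_def)
      show "total_flow ?W' l = (if l \<in> {x, y} then 0 else total_flow ?W l)" for l
        using d by (cases "l = x"; cases "l = y"; simp add: algebra_simps)
    next
      fix f g :: "nat \<Rightarrow> 'k"
      assume f: "\<forall>v\<in>set (map fst ?W'). fox f v"
      then show "\<forall>v\<in>set (map fst ?W). fox (?F f) v"
        by (simp (no_asm_use) only: colouring_simps d d[symmetric]) (rule R2_values_backward(1))
      assume "\<forall>t\<in>set ?W. lift (?F f) g t"
      with f show "\<forall>t\<in>set ?W'. lift f (?G f g) t"
        by (simp (no_asm_use) only: colouring_simps d d[symmetric]) (rule R2_values_backward(2))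
    qed simp_all
    then show "\<exists>W'. map fst W' = ?L \<and> local_lift TYPE('k) {x, y} W W'"
      unfolding W' by (intro exI[of _ ?W'] conjI) simp_all
  qed (rule S)
  then show ?thesis by simp
qed

lemma R3a_values_forward:
  fixes fa1 fa2 fb1 fb2 fc1 fc2 fx fy fz ga1 ga2 gb1 gb2 gc1 gc2 gx gy gz :: "'k::comm_ring_1"
  assumes "fox_at fa2 fb2 fx fy \<and> fox_at fx fc2 fa1 fz \<and> fox_at fy fz fb1 fc1"
  shows "fox_at (2 * fb1 - fa1) fb1 fa1 fb1 \<and> fox_at fa2 fc1 (2 * fb1 - fa1) fc1 \<and> fox_at fb2 fc2
      fb1 fc1"
    "lift_at v fb1 fa1 gx gy ga1 gb1 \<and> lift_at w fc1 (2 * fb1 - fa1) ga2 gz gx gc1 \<and> lift_at w fc2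
        fb1 gb2 gc2 gy gz \<Longrightarrow>
     lift_at v fb2 fx ga2 gb2 (2 * gb2 - ga2 + of_int v * 2 * (fx - fb2)) gb2 \<and> lift_at w fc2 fa1
         (2 * gb2 - ga2 + of_int v * 2 * (fx - fb2)) gc2 ga1 gc2 \<and> lift_at w fz fb1 gb2 gc2 gb1
         gc1"
  using assms unfolding fox_at_def lift_at_def by (clarify, simp add: algebra_simps)+

lemma R3a_values_backward:
  fixes fa1 fa2 fb1 fb2 fc1 fc2 fx fy fz ga1 ga2 gb1 gb2 gc1 gc2 gx gy gz :: "'k::comm_ring_1"
  assumes "fox_at fx fy fa1 fb1 \<and> fox_at fa2 fz fx fc1 \<and> fox_at fb2 fc2 fy fz"
  shows "fox_at fa2 fb2 (2 * fb2 - fa2) fb2 \<and> fox_at (2 * fb2 - fa2) fc2 fa1 fc2 \<and> fox_at fb2 fc2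
      fb1 fc1"
    "lift_at v fb2 (2 * fb2 - fa2) ga2 gb2 gx gy \<and> lift_at w fc2 fa1 gx gc2 ga1 gz \<and> lift_at w fc2
        fb1 gy gz gb1 gc1 \<Longrightarrow>
     lift_at v fy fa1 (2 * gb1 - ga1 + of_int v * 2 * (fa1 - fb1)) gb1 ga1 gb1 \<and> lift_at w fz fx
         ga2 gc1 (2 * gb1 - ga1 + of_int v * 2 * (fa1 - fb1)) gc1 \<and> lift_at w fc2 fy gb2 gc2 gb1
         gc1"
  using assms unfolding fox_at_def lift_at_def by (clarify, simp add: algebra_simps)+

lemma liftable_R3a_iff:
  assumes "well_labelled (Crossing x y a1 b1 # Crossing a2 z x c1 # Crossing b2 c2 y z # R)"
  shows "liftable TYPE('k::comm_ring_1) (Crossing x y a1 b1 # Crossing a2 z x c1 # Crossing b2 c2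
      y z # R) \<longleftrightarrow>
    liftable TYPE('k) (Crossing a2 b2 x y # Crossing x c2 a1 z # Crossing y z b1 c1 # R)"
proof -
  have d: "x \<noteq> y" "x \<noteq> z" "x \<noteq> a1" "x \<noteq> a2" "x \<noteq> b1" "x \<noteq> b2" "x \<noteq> c1" "x \<noteq> c2" "y \<noteq> z" "y \<noteq> a1"
      "y \<noteq> a2" "y \<noteq> b1" "y \<noteq> b2" "y \<noteq> c1" "y \<noteq> c2" "z \<noteq> a1" "z \<noteq> a2" "z \<noteq> b1" "z \<noteq> b2" "z \<noteq> c1" "z
      \<noteq> c2"
    using well_labelled_occurrences_le[OF assms, of x] well_labelled_occurrences_le[OF assms, of
        y] well_labelled_occurrences_le[OF assms, of z]
    by (intro notI; simp add: count_list_Cons del: count_list.simps(2))+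
  have S: "{x, y, z} \<inter> labels R = {}"
    using fresh_labels[of "[Crossing x y a1 b1, Crossing a2 z x c1, Crossing b2 c2 y z]" R "{x, y,
        z}"] assms d by simp
  let ?L = "[Crossing x y a1 b1, Crossing a2 z x c1, Crossing b2 c2 y z]" and ?L' = "[Crossing a2
      b2 x y, Crossing x c2 a1 z, Crossing y z b1 c1]"
  have "liftable TYPE('k) (?L @ R) \<longleftrightarrow> liftable TYPE('k) (?L' @ R)"
  proof (rule liftable_local_iff[of "{x, y, z}" R ?L ?L'])
    fix W assume W: "map fst W = ?L" "signed W" "\<forall>l\<in>{x, y, z}. total_flow W l = 0"
    from W(1) obtain u1 w1 u2 w2 u3 w3 where W': "W = [(Crossing x y a1 b1, u1, w1), (Crossing a2
        z x c1, u2, w2), (Crossing b2 c2 y z, u3, w3)]"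
      by (auto simp: map_eq_Cons_conv)
    have e: "u2 = u1" "u3 = w1" "w3 = w2"
    proof -
      have "total_flow W x = u2 - u1" "total_flow W y = u3 - w1" "total_flow W z = w3 - w2"
        using d by (simp_all add: W')
      moreover have "total_flow W x = 0" "total_flow W y = 0" "total_flow W z = 0"
        using W(3) by simp_all
      ultimately show "u2 = u1" "u3 = w1" "w3 = w2"
        by - linarith+
    qed
    let ?W = "[(Crossing x y a1 b1, u1, w1), (Crossing a2 z x c1, u1, w2), (Crossing b2 c2 y z,
        w1, w2)]"
    let ?W' = "[(Crossing a2 b2 x y, u1, w1), (Crossing x c2 a1 z, u1, w2), (Crossing y z b1 c1,
        w1, w2)]"
    let ?F = "\<lambda>f :: nat \<Rightarrow> 'k. f(x := 2 * f b1 - f a1, y := f b1, z := f c1)"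
    let ?G = "\<lambda>f g :: nat \<Rightarrow> 'k. g(x := 2 * g b2 - g a2 + of_int w1 * 2 * (f x - f b2), y := g b2,
        z := g c2)"
    have "local_lift TYPE('k) {x, y, z} ?W ?W'"
    proof (rule local_liftI[where F = ?F and G = ?G])
      show "signed ?W'" using W(2) unfolding W' by (auto simp: signed_def)
      show "total_flow ?W' l = (if l \<in> {x, y, z} then 0 else total_flow ?W l)" for l
        using d by (cases "l = x"; cases "l = y"; cases "l = z"; simp add: algebra_simps)
    next
      fix f g :: "nat \<Rightarrow> 'k"
      assume f: "\<forall>v\<in>set (map fst ?W'). fox f v"
      then show "\<forall>v\<in>set (map fst ?W). fox (?F f) v"
        by (simp (no_asm_use) only: colouring_simps d d[symmetric]) (rule R3a_values_forward(1))
      assume "\<forall>t\<in>set ?W. lift (?F f) g t"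
      with f show "\<forall>t\<in>set ?W'. lift f (?G f g) t"
        by (simp (no_asm_use) only: colouring_simps d d[symmetric]) (rule R3a_values_forward(2))
    qed simp_all
    then show "\<exists>W'. map fst W' = ?L' \<and> local_lift TYPE('k) {x, y, z} W W'"
      unfolding W' e by (intro exI[of _ ?W'] conjI) simp_all
  next
    fix W assume W: "map fst W = ?L'" "signed W" "\<forall>l\<in>{x, y, z}. total_flow W l = 0"
    from W(1) obtain u1 w1 u2 w2 u3 w3 where W': "W = [(Crossing a2 b2 x y, u1, w1), (Crossing x
        c2 a1 z, u2, w2), (Crossing y z b1 c1, u3, w3)]"
      by (auto simp: map_eq_Cons_conv)
    have e: "u2 = u1" "u3 = w1" "w3 = w2"
    proof -
      have "total_flow W x = u1 - u2" "total_flow W y = w1 - u3" "total_flow W z = w2 - w3"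
        using d by (simp_all add: W')
      moreover have "total_flow W x = 0" "total_flow W y = 0" "total_flow W z = 0"
        using W(3) by simp_all
      ultimately show "u2 = u1" "u3 = w1" "w3 = w2"
        by - linarith+
    qed
    let ?W = "[(Crossing a2 b2 x y, u1, w1), (Crossing x c2 a1 z, u1, w2), (Crossing y z b1 c1,
        w1, w2)]"
    let ?W' = "[(Crossing x y a1 b1, u1, w1), (Crossing a2 z x c1, u1, w2), (Crossing b2 c2 y z,
        w1, w2)]"
    let ?F = "\<lambda>f :: nat \<Rightarrow> 'k. f(x := 2 * f b2 - f a2, y := f b2, z := f c2)"
    let ?G = "\<lambda>f g :: nat \<Rightarrow> 'k. g(x := 2 * g b1 - g a1 + of_int w1 * 2 * (f a1 - f b1), y := g b1,
        z := g c1)"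
    have "local_lift TYPE('k) {x, y, z} ?W ?W'"
    proof (rule local_liftI[where F = ?F and G = ?G])
      show "signed ?W'" using W(2) unfolding W' by (auto simp: signed_def)
      show "total_flow ?W' l = (if l \<in> {x, y, z} then 0 else total_flow ?W l)" for l
        using d by (cases "l = x"; cases "l = y"; cases "l = z"; simp add: algebra_simps)
    next
      fix f g :: "nat \<Rightarrow> 'k"
      assume f: "\<forall>v\<in>set (map fst ?W'). fox f v"
      then show "\<forall>v\<in>set (map fst ?W). fox (?F f) v"
        by (simp (no_asm_use) only: colouring_simps d d[symmetric]) (rule R3a_values_backward(1))
      assume "\<forall>t\<in>set ?W. lift (?F f) g t"
      with f show "\<forall>t\<in>set ?W'. lift f (?G f g) t"
        by (simp (no_asm_use) only: colouring_simps d d[symmetric]) (rule R3a_values_backward(2))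
    qed simp_all
    then show "\<exists>W'. map fst W' = ?L \<and> local_lift TYPE('k) {x, y, z} W W'"
      unfolding W' e by (intro exI[of _ ?W'] conjI) simp_all
  qed (rule S)
  then show ?thesis by simp
qed

lemma R3b_values_forward:
  fixes fa1 fa2 fb1 fb2 fc1 fc2 fx fy fz ga1 ga2 gb1 gb2 gc1 gc2 gx gy gz :: "'k::comm_ring_1"
  assumes "fox_at fb2 fx fy fa2 \<and> fox_at fx fc2 fa1 fz \<and> fox_at fy fz fb1 fc1"
  shows "fox_at (2 * fa1 - fb1) fa1 fb1 fa1 \<and> fox_at fa2 fc1 fa1 fc1 \<and> fox_at fb2 fc2 (2 * fa1 -
      fb1) fc1"
    "lift_at (- u) fa1 fb1 gy ga1 gb1 gx \<and> lift_at w fc1 fa1 ga2 gz gx gc1 \<and> lift_at w fc2 (2 *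
        fa1 - fb1) gb2 gc2 gy gz \<Longrightarrow>
     lift_at (- u) fx fy gb2 ga2 (2 * ga2 - gb2 - of_int u * 2 * (fy - fa2)) ga2 \<and> lift_at w fc2
         fa1 ga2 gc2 ga1 gc2 \<and> lift_at w fz fb1 (2 * ga2 - gb2 - of_int u * 2 * (fy - fa2)) gc2
         gb1 gc1"
  using assms unfolding fox_at_def lift_at_def by (clarify, simp add: algebra_simps)+

lemma R3b_values_backward:
  fixes fa1 fa2 fb1 fb2 fc1 fc2 fx fy fz ga1 ga2 gb1 gb2 gc1 gc2 gx gy gz :: "'k::comm_ring_1"
  assumes "fox_at fy fa1 fb1 fx \<and> fox_at fa2 fz fx fc1 \<and> fox_at fb2 fc2 fy fz"
  shows "fox_at fb2 fa2 (2 * fa2 - fb2) fa2 \<and> fox_at fa2 fc2 fa1 fc2 \<and> fox_at (2 * fa2 - fb2) fc2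
      fb1 fc1"
    "lift_at (- u) fa2 (2 * fa2 - fb2) gb2 gx gy ga2 \<and> lift_at w fc2 fa1 gx gc2 ga1 gz \<and> lift_at w
        fc2 fb1 gy gz gb1 gc1 \<Longrightarrow>
     lift_at (- u) fa1 fb1 (2 * ga1 - gb1 - of_int u * 2 * (fb1 - fa1)) ga1 gb1 ga1 \<and> lift_at w fz
         fx ga2 gc1 ga1 gc1 \<and> lift_at w fc2 fy gb2 gc2 (2 * ga1 - gb1 - of_int u * 2 * (fb1 -
         fa1)) gc1"
  using assms unfolding fox_at_def lift_at_def by (clarify, simp add: algebra_simps)+

lemma liftable_R3b_iff:
  assumes "well_labelled (Crossing y a1 b1 x # Crossing a2 z x c1 # Crossing b2 c2 y z # R)"
  shows "liftable TYPE('k::comm_ring_1) (Crossing y a1 b1 x # Crossing a2 z x c1 # Crossing b2 c2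
      y z # R) \<longleftrightarrow>
    liftable TYPE('k) (Crossing b2 x y a2 # Crossing x c2 a1 z # Crossing y z b1 c1 # R)"
proof -
  have d: "x \<noteq> y" "x \<noteq> z" "x \<noteq> a1" "x \<noteq> a2" "x \<noteq> b1" "x \<noteq> b2" "x \<noteq> c1" "x \<noteq> c2" "y \<noteq> z" "y \<noteq> a1"
      "y \<noteq> a2" "y \<noteq> b1" "y \<noteq> b2" "y \<noteq> c1" "y \<noteq> c2" "z \<noteq> a1" "z \<noteq> a2" "z \<noteq> b1" "z \<noteq> b2" "z \<noteq> c1" "z
      \<noteq> c2"
    using well_labelled_occurrences_le[OF assms, of x] well_labelled_occurrences_le[OF assms, of
        y] well_labelled_occurrences_le[OF assms, of z]
    by (intro notI; simp add: count_list_Cons del: count_list.simps(2))+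
  have S: "{x, y, z} \<inter> labels R = {}"
    using fresh_labels[of "[Crossing y a1 b1 x, Crossing a2 z x c1, Crossing b2 c2 y z]" R "{x, y,
        z}"] assms d by simp
  let ?L = "[Crossing y a1 b1 x, Crossing a2 z x c1, Crossing b2 c2 y z]" and ?L' = "[Crossing b2
      x y a2, Crossing x c2 a1 z, Crossing y z b1 c1]"
  have "liftable TYPE('k) (?L @ R) \<longleftrightarrow> liftable TYPE('k) (?L' @ R)"
  proof (rule liftable_local_iff[of "{x, y, z}" R ?L ?L'])
    fix W assume W: "map fst W = ?L" "signed W" "\<forall>l\<in>{x, y, z}. total_flow W l = 0"
    from W(1) obtain u1 w1 u2 w2 u3 w3 where W': "W = [(Crossing y a1 b1 x, u1, w1), (Crossing a2
        z x c1, u2, w2), (Crossing b2 c2 y z, u3, w3)]"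
      by (auto simp: map_eq_Cons_conv)
    have e: "w1 = - u2" "u3 = u1" "w3 = w2"
    proof -
      have "total_flow W x = w1 + u2" "total_flow W y = u3 - u1" "total_flow W z = w3 - w2"
        using d by (simp_all add: W')
      moreover have "total_flow W x = 0" "total_flow W y = 0" "total_flow W z = 0"
        using W(3) by simp_all
      ultimately show "w1 = - u2" "u3 = u1" "w3 = w2"
        by - linarith+
    qed
    let ?W = "[(Crossing y a1 b1 x, u1, - u2), (Crossing a2 z x c1, u2, w2), (Crossing b2 c2 y z,
        u1, w2)]"
    let ?W' = "[(Crossing b2 x y a2, u1, - u2), (Crossing x c2 a1 z, u2, w2), (Crossing y z b1 c1,
        u1, w2)]"
    let ?F = "\<lambda>f :: nat \<Rightarrow> 'k. f(x := f a1, y := 2 * f a1 - f b1, z := f c1)"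
    let ?G = "\<lambda>f g :: nat \<Rightarrow> 'k. g(x := g a2, y := 2 * g a2 - g b2 - of_int u2 * 2 * (f y - f a2),
        z := g c2)"
    have "local_lift TYPE('k) {x, y, z} ?W ?W'"
    proof (rule local_liftI[where F = ?F and G = ?G])
      show "signed ?W'" using W(2) unfolding W' by (auto simp: signed_def)
      show "total_flow ?W' l = (if l \<in> {x, y, z} then 0 else total_flow ?W l)" for l
        using d by (cases "l = x"; cases "l = y"; cases "l = z"; simp add: algebra_simps)
    next
      fix f g :: "nat \<Rightarrow> 'k"
      assume f: "\<forall>v\<in>set (map fst ?W'). fox f v"
      then show "\<forall>v\<in>set (map fst ?W). fox (?F f) v"
        by (simp (no_asm_use) only: colouring_simps d d[symmetric]) (rule R3b_values_forward(1))
      assume "\<forall>t\<in>set ?W. lift (?F f) g t"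
      with f show "\<forall>t\<in>set ?W'. lift f (?G f g) t"
        by (simp (no_asm_use) only: colouring_simps d d[symmetric]) (rule R3b_values_forward(2))
    qed simp_all
    then show "\<exists>W'. map fst W' = ?L' \<and> local_lift TYPE('k) {x, y, z} W W'"
      unfolding W' e by (intro exI[of _ ?W'] conjI) simp_all
  next
    fix W assume W: "map fst W = ?L'" "signed W" "\<forall>l\<in>{x, y, z}. total_flow W l = 0"
    from W(1) obtain u1 w1 u2 w2 u3 w3 where W': "W = [(Crossing b2 x y a2, u1, w1), (Crossing x
        c2 a1 z, u2, w2), (Crossing y z b1 c1, u3, w3)]"
      by (auto simp: map_eq_Cons_conv)
    have e: "w1 = - u2" "u3 = u1" "w3 = w2"
    proof -
      have "total_flow W x = - w1 - u2" "total_flow W y = u1 - u3" "total_flow W z = w2 - w3"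
        using d by (simp_all add: W')
      moreover have "total_flow W x = 0" "total_flow W y = 0" "total_flow W z = 0"
        using W(3) by simp_all
      ultimately show "w1 = - u2" "u3 = u1" "w3 = w2"
        by - linarith+
    qed
    let ?W = "[(Crossing b2 x y a2, u1, - u2), (Crossing x c2 a1 z, u2, w2), (Crossing y z b1 c1,
        u1, w2)]"
    let ?W' = "[(Crossing y a1 b1 x, u1, - u2), (Crossing a2 z x c1, u2, w2), (Crossing b2 c2 y z,
        u1, w2)]"
    let ?F = "\<lambda>f :: nat \<Rightarrow> 'k. f(x := f a2, y := 2 * f a2 - f b2, z := f c2)"
    let ?G = "\<lambda>f g :: nat \<Rightarrow> 'k. g(x := g a1, y := 2 * g a1 - g b1 - of_int u2 * 2 * (f b1 - f a1),
        z := g c1)"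
    have "local_lift TYPE('k) {x, y, z} ?W ?W'"
    proof (rule local_liftI[where F = ?F and G = ?G])
      show "signed ?W'" using W(2) unfolding W' by (auto simp: signed_def)
      show "total_flow ?W' l = (if l \<in> {x, y, z} then 0 else total_flow ?W l)" for l
        using d by (cases "l = x"; cases "l = y"; cases "l = z"; simp add: algebra_simps)
    next
      fix f g :: "nat \<Rightarrow> 'k"
      assume f: "\<forall>v\<in>set (map fst ?W'). fox f v"
      then show "\<forall>v\<in>set (map fst ?W). fox (?F f) v"
        by (simp (no_asm_use) only: colouring_simps d d[symmetric]) (rule R3b_values_backward(1))
      assume "\<forall>t\<in>set ?W. lift (?F f) g t"
      with f show "\<forall>t\<in>set ?W'. lift f (?G f g) t"
        by (simp (no_asm_use) only: colouring_simps d d[symmetric]) (rule R3b_values_backward(2))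
    qed simp_all
    then show "\<exists>W'. map fst W' = ?L \<and> local_lift TYPE('k) {x, y, z} W W'"
      unfolding W' e by (intro exI[of _ ?W'] conjI) simp_all
  qed (rule S)
  then show ?thesis by simp
qed

end

section \<open>Invariance\<close>

lemma liftable_move:
  assumes "move D D'" "well_labelled D"
  shows "liftable TYPE('k::comm_ring_1) D \<longleftrightarrow> liftable TYPE('k) D'"
  using assms
proof (induction rule: move.induct)
  case (permute D D')
  then show ?case using liftable_permute[of D D'] liftable_permute[of D' D] by metis
next
  case (rename f D)
  then show ?case using liftable_rename_iff[of f D, where 'k = 'k] by simp
next
  case (turn_crossing a b c d D)
  show ?case by (rule liftable_turn_crossing_iff)
next
  case (turn_point a b D)
  show ?case by (rule liftable_turn_point_iff)
next
  case (absorb a b D)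
  then show ?case by (rule liftable_absorb_iff)
next
  case (R1a a x b D)
  then show ?case by (rule liftable_R1a_iff)
next
  case (R1b x b a D)
  then show ?case by (rule liftable_R1b_iff)
next
  case (R2 a b x y d c D)
  then show ?case by (rule liftable_R2_iff)
next
  case (R3a x y a1 b1 a2 z c1 b2 c2 D)
  then show ?case by (rule liftable_R3a_iff)
next
  case (R3b y a1 b1 x a2 z c1 b2 c2 D)
  then show ?case by (rule liftable_R3b_iff)
qed

lemma liftable_knot_of:
  assumes "D' \<in> knot_of D"
  shows "liftable TYPE('k::comm_ring_1) D \<longleftrightarrow> liftable TYPE('k) D'"
proof -
  have "equivclp (\<lambda>D D'. knot_diagram D \<and> knot_diagram D' \<and> move D D') D D'"
    using assms by (simp add: knot_of_def reidemeister_equivalent_def)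
  then show ?thesis
  proof (induction rule: equivclp_induct)
    case (step y z)
    then have "liftable TYPE('k) y \<longleftrightarrow> liftable TYPE('k) z"
      using liftable_move[of y z] liftable_move[of z y] by (metis knot_diagram_def)
    then show ?case using step.IH by simp
  qed simp
qed

section \<open>Closed functions on the edges of a spherical diagram\<close>

lemma mate:
  assumes "well_labelled D" "d \<in> darts D"
  shows "mate D d \<in> darts D" "mate D d \<noteq> d" "label D (mate D d) = label D d"
    "mate D (mate D d) = d"
proof -
  let ?P = "\<lambda>d d'. d' \<in> darts D \<and> d' \<noteq> d \<and> label D d' = label D d"
  have ex: "\<exists>!d'. ?P d d'" if "d \<in> darts D" for d
    using assms(1) that unfolding well_labelled_def by blast
  have P: "?P d (mate D d)" unfolding mate_def by (rule theI'[OF ex[OF assms(2)]])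
  then show m: "mate D d \<in> darts D" "mate D d \<noteq> d" "label D (mate D d) = label D d" by auto
  have "?P (mate D d) d" using P assms(2) by metis
  then show "mate D (mate D d) = d"
    unfolding mate_def[of D "mate D d"] by (rule the1_equality[OF ex[OF m(1)]])
qed

lemma mate_unique:
  assumes "well_labelled D" "d \<in> darts D" "e \<in> darts D" "e \<noteq> d" "label D e = label D d"
  shows "e = mate D d"
  unfolding mate_def
  by (rule the1_equality[symmetric]) (use assms in \<open>simp_all add: well_labelled_def\<close>)

lemma darts_ccw: "d \<in> darts D \<Longrightarrow> ccw D d \<in> darts D"
  by (cases d) (auto simp: darts_def ccw_def intro!: mod_less_divisor)

lemma fst_ccw [simp]: "fst (ccw D d) = fst d"
  by (cases d) (simp add: ccw_def)

lemma fst_across [simp]: "fst (across D d) = fst d"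
  by (cases d) (simp add: across_def)

definition darts_at :: "diagram \<Rightarrow> nat \<Rightarrow> dart set" where
  "darts_at D i = {d \<in> darts D. fst d = i}"

lemma finite_darts_at [simp]: "finite (darts_at D i)"
  using finite_darts[of D] by (auto simp: darts_at_def)

lemma darts_at_eq: "i < length D \<Longrightarrow> darts_at D i = Pair i ` {..<length (ends (D ! i))}"
  by (auto simp: darts_at_def darts_def)

lemma darts_at_Crossing:
  "i < length D \<Longrightarrow> D ! i = Crossing a b c d \<Longrightarrow> darts_at D i = {(i, 0), (i, 1), (i, 2), (i, 3)}"
  by (auto simp: darts_at_eq lessThan_Suc numeral_eq_Suc)

lemma darts_at_Point: "i < length D \<Longrightarrow> D ! i = Point a b \<Longrightarrow> darts_at D i = {(i, 0), (i, 1)}"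
  by (auto simp: darts_at_eq lessThan_Suc numeral_eq_Suc)

lemma ccw_bij_darts_at: "bij_betw (ccw D) (darts_at D i) (darts_at D i)"
proof (cases "i < length D")
  case True
  show ?thesis
  proof (cases "D ! i")
    case (Crossing a b c d)
    then show ?thesis
      using True by (auto simp: darts_at_Crossing bij_betw_def inj_on_def ccw_def)
  next
    case (Point a b)
    then show ?thesis
      using True by (auto simp: darts_at_Point bij_betw_def inj_on_def ccw_def)
  qed
next
  case False
  then have "darts_at D i = {}" by (auto simp: darts_at_def darts_def)
  then show ?thesis by (simp add: bij_betw_def)
qed

lemma inj_on_ccw: "inj_on (ccw D) (darts D)"
proof (rule inj_onI)
  fix d e assume *: "d \<in> darts D" "e \<in> darts D" "ccw D d = ccw D e"
  then have "fst d = fst e" by (metis fst_ccw)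
  then have "d \<in> darts_at D (fst d)" "e \<in> darts_at D (fst d)" using * by (auto simp: darts_at_def)
  then show "d = e" using ccw_bij_darts_at[of D "fst d"] * by (auto simp: bij_betw_def inj_on_def)
qed

text \<open>
  The permutation whose orbits are the faces is only meaningful on the darts of the diagram, so
  it is first cut down to them.
\<close>

lemma orbit_faces:
  assumes "well_labelled D" "d \<in> darts D"
  shows "orbit (ccw D \<circ> mate D) (ccw D (mate D d)) = orbit (ccw D \<circ> mate D) d"
proof -
  let ?F = "ccw D \<circ> mate D"
  define G where "G e = (if e \<in> darts D then ?F e else e)" for e
  have F: "?F e \<in> darts D" if "e \<in> darts D" for e
    using mate(1)[OF assms(1) that] darts_ccw by simp
  have "inj_on ?F (darts D)"
  proof (rule comp_inj_on)
    show "inj_on (mate D) (darts D)" using mate(4)[OF assms(1)] by (rule inj_on_inverseI)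
    show "inj_on (ccw D) (mate D ` darts D)"
      by (rule inj_on_subset[OF inj_on_ccw]) (use mate(1)[OF assms(1)] in blast)
  qed
  then have "bij_betw ?F (darts D) (darts D)"
    unfolding bij_betw_def using endo_inj_surj[OF finite_darts] F by blast
  then have "bij_betw G (darts D) (darts D)"
    by (subst bij_betw_cong[of _ _ ?F]) (auto simp: G_def)
  then have perm: "G permutes darts D" by (rule bij_imp_permutes) (simp add: G_def)
  have orb: "orbit ?F e = orbit G e" if "e \<in> darts D" for e
    by (rule orbit_cong0[of e "darts D"]) (use that F in \<open>auto simp: G_def\<close>)
  have "permutation G" using perm finite_darts permutation_permutes by blast
  then have "d \<in> orbit G (G d)" "G d \<in> orbit G d"
    by (auto intro: permutation_self_in_orbit orbit.base simp: permutation_orbit_step)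
  then have "orbit G (G d) = orbit G d"
    by (metis \<open>permutation G\<close> permutation_orbit_step)
  then show ?thesis using orb[OF assms(2)] orb[OF F[OF assms(2)]] by (simp add: G_def assms(2))
qed

text \<open>
  Functions are normalised to vanish outside their domain, so that they can be counted.
\<close>

definition supported :: "'a set \<Rightarrow> ('a \<Rightarrow> 'k::zero) set" where
  "supported A = {f. \<forall>x. x \<notin> A \<longrightarrow> f x = 0}"

lemma card_supported:
  assumes "finite A"
  shows "finite (supported A :: ('a \<Rightarrow> 'k::{zero,finite}) set)"
    "card (supported A :: ('a \<Rightarrow> 'k) set) = CARD('k) ^ card A"
proof -
  let ?r = "\<lambda>f :: 'a \<Rightarrow> 'k. restrict f A"
  have "bij_betw ?r (supported A) (A \<rightarrow>\<^sub>E UNIV)"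
  proof (rule bij_betw_byWitness[of _ "\<lambda>f x. if x \<in> A then f x else 0"])
    show "\<forall>f\<in>supported A. (\<lambda>x. if x \<in> A then ?r f x else 0) = f"
      by (auto simp: supported_def)
    show "\<forall>f\<in>A \<rightarrow>\<^sub>E UNIV. ?r (\<lambda>x. if x \<in> A then f x else 0) = f"
      by (auto simp: fun_eq_iff PiE_def extensional_def)
  qed (auto simp: supported_def)
  moreover have "finite (A \<rightarrow>\<^sub>E (UNIV :: 'k set))" using assms by (simp add: finite_PiE)
  moreover have "card (A \<rightarrow>\<^sub>E (UNIV :: 'k set)) = CARD('k) ^ card A"
    using assms by (simp add: card_PiE)
  ultimately show "finite (supported A :: ('a \<Rightarrow> 'k) set)"
    "card (supported A :: ('a \<Rightarrow> 'k) set) = CARD('k) ^ card A"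
    using bij_betw_finite bij_betw_same_card by metis+
qed

lemma across_cases:
  assumes "d \<in> darts D"
  obtains "across D d = ccw D d" "\<not> is_crossing (D ! fst d)"
  | "across D d = ccw D (ccw D d)" "is_crossing (D ! fst d)"
  by (cases d; cases "D ! fst d") (use that in \<open>auto simp: across_def ccw_def mod_simps\<close>)

lemma one_component_induct:
  assumes "one_component D" "d \<in> darts D" "e \<in> darts D" "P d"
    and "\<And>d. d \<in> darts D \<Longrightarrow> P d \<Longrightarrow> P (mate D d)" "\<And>d. d \<in> darts D \<Longrightarrow> P d \<Longrightarrow> P (across D d)"
  shows "P e"
proof -
  have "(d, e) \<in> ({(e, mate D e) | e. e \<in> darts D} \<union> {(e, across D e) | e. e \<in> darts D})\<^sup>*"
    using assms(1-3) unfolding one_component_def by blast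
  then show ?thesis by (induction rule: rtrancl_induct) (use assms(4-6) in auto)
qed

text \<open>
  Let \<open>V\<close>, \<open>E\<close>, \<open>F\<close> be the numbers of vertices, edges and faces, and \<open>q\<close> the order of the
  coefficient group. The coboundary \<open>cob\<close> maps the \<open>q ^ F\<close> functions on the faces to closed
  functions on the edges, and its fibres have at most \<open>q\<close> elements, since the diagram is
  connected. The boundary \<open>bd\<close> maps the \<open>q ^ E\<close> functions on the edges onto at least
  \<open>q ^ (V - 1)\<close> functions on the vertices, for the same reason, so at most \<open>q ^ (E - V + 1)\<close>
  functions are closed. By Euler's formula this number is \<open>q ^ (F - 1)\<close>, so every closed
  function is a coboundary. The face to the right of a dart \<open>d\<close>, seen from its vertex, is the
  one that contains \<open>d\<close> as an orbit, and \<open>ccw D d\<close> belongs to the face on the left.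
\<close>

lemma closed_imp_face_potential:
  fixes \<delta> :: "dart \<Rightarrow> 'k::{finite, ab_group_add}"
  assumes D: "knot_diagram D" and out: "orientation D out"
    and anti: "\<And>d. d \<in> darts D \<Longrightarrow> \<delta> (mate D d) = - \<delta> d"
    and closed: "\<And>i. i < length D \<Longrightarrow> sum \<delta> (darts_at D i) = 0"
  obtains \<Phi> where "\<And>d. d \<in> darts D \<Longrightarrow> \<Phi> (ccw D (mate D d)) = \<Phi> d"
    "\<And>d. d \<in> darts D \<Longrightarrow> \<delta> d = \<Phi> (ccw D d) - \<Phi> d"
proof -
  define A where "A = darts D"
  define m where "m = mate D"
  define c where "c = ccw D"
  define q where "q = CARD('k)"
  have wl: "well_labelled D" and conn: "one_component D" and planar: "planar D"
    using D by (auto simp: knot_diagram_def)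
  have m: "m d \<in> A" "m d \<noteq> d" "m (m d) = d" if "d \<in> A" for d
    using mate[OF wl] that by (auto simp: A_def m_def)
  have c: "c d \<in> A" if "d \<in> A" for d
    using darts_ccw that by (auto simp: A_def c_def)
  have finA: "finite A" by (simp add: A_def finite_darts)
  have at: "darts_at D i = {d \<in> A. fst d = i}" for i by (auto simp: darts_at_def A_def)
  have outm: "out (m d) \<longleftrightarrow> \<not> out d" if "d \<in> A" for d
    using out that by (auto simp: orientation_def A_def m_def)
  have q: "q > 0" by (simp add: q_def)

  have "D \<noteq> []" using planar by (auto simp: planar_def darts_def faces_def)
  then have d0: "(0, 0) \<in> A" by (cases "D ! 0") (auto simp: A_def darts_def)

  define X :: "(dart \<Rightarrow> 'k) set" where "X = {f \<in> supported A. \<forall>d\<in>A. f (m d) = - f d}"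
  define Y :: "(dart \<Rightarrow> 'k) set" where "Y = {f \<in> supported A. \<forall>d\<in>A. f (c (m d)) = f d}"
  define cob :: "(dart \<Rightarrow> 'k) \<Rightarrow> dart \<Rightarrow> 'k"
    where "cob f = (\<lambda>d. if d \<in> A then f (c d) - f d else 0)" for f
  define bd :: "(dart \<Rightarrow> 'k) \<Rightarrow> nat \<Rightarrow> 'k" where "bd f = (\<lambda>i. sum f (darts_at D i))" for f
  define Z where "Z = {f \<in> X. \<forall>i. bd f i = 0}"
  have fin: "finite X" "finite Y"
    using card_supported(1)[OF finA, where 'k = 'k] by (simp_all add: X_def Y_def)
  have finZ: "finite Z" using fin by (simp add: Z_def)

  have cob_Z: "cob f \<in> Z" if "f \<in> Y" for f
  proof -
    have "cob f (m d) = - cob f d" if d: "d \<in> A" for d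
    proof -
      have "f (m d) = f (c d)" using \<open>f \<in> Y\<close> m[OF d] by (force simp: Y_def)
      moreover have "f (c (m d)) = f d" using \<open>f \<in> Y\<close> d by (simp add: Y_def)
      ultimately show ?thesis using d m by (simp add: cob_def)
    qed
    moreover have "bd (cob f) i = 0" for i
    proof -
      have "bd (cob f) i = (\<Sum>d\<in>darts_at D i. f (c d)) - sum f (darts_at D i)"
        by (simp add: bd_def cob_def at sum_subtractf)
      then show ?thesis
        using sum.reindex_bij_betw[OF ccw_bij_darts_at[of D i], of f] by (simp add: c_def)
    qed
    ultimately show ?thesis by (auto simp: Z_def X_def supported_def cob_def)
  qed

  have card_O: "card A div 2 = card {d \<in> A. out d}"
  proof -
    let ?O = "{d \<in> A. out d}"
    have "A = ?O \<union> m ` ?O"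
    proof (intro equalityI subsetI)
      fix d assume d: "d \<in> A"
      show "d \<in> ?O \<union> m ` ?O"
      proof (cases "out d")
        case False
        then have "m d \<in> ?O" using d m outm by auto
        then have "m (m d) \<in> m ` ?O" by (rule imageI)
        then show ?thesis using m(3)[OF d] by simp
      qed (use d in simp)
    qed (use m in auto)
    moreover have "?O \<inter> m ` ?O = {}" using outm by auto
    moreover have "inj_on m ?O" by (rule inj_on_inverseI[of _ m]) (use m in auto)
    ultimately have "card A = card ?O + card ?O"
      using finA card_Un_disjoint[of ?O "m ` ?O"] card_image[of m ?O] by simp
    then show ?thesis by simp
  qed

  have X_le: "card X \<le> q ^ card {d \<in> A. out d}"
  proof -
    let ?O = "{d \<in> A. out d}" and ?r = "\<lambda>(f :: dart \<Rightarrow> 'k) d. if d \<in> A \<and> out d then f d else 0"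
    have "inj_on ?r X"
    proof (rule inj_onI)
      fix f g assume fg: "f \<in> X" "g \<in> X" "?r f = ?r g"
      have eq: "f d = g d" if "d \<in> A" "out d" for d
        using fun_cong[OF fg(3), of d] that by simp
      have "f d = g d" if d: "d \<in> A" for d
      proof (cases "out d")
        case False
        then have "f (m d) = g (m d)" using eq m(1)[OF d] outm[OF d] by simp
        then show ?thesis using fg(1,2) d by (simp add: X_def)
      qed (use eq d in simp)
      then show "f = g" using fg(1,2) by (fastforce simp: X_def supported_def)
    qed
    moreover have "?r ` X \<subseteq> supported ?O" by (auto simp: supported_def)
    moreover have "finite ?O" using finA by simp
    ultimately show ?thesis
      using card_inj_on_le[of ?r X "supported ?O"] card_supported[of ?O, where 'k = 'k]
      by (simp add: q_def)
  qed

  have finF: "finite (faces D)" by (simp add: faces_def finite_darts)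
  have Y_ge: "q ^ card (faces D) \<le> card Y"
  proof -
    let ?o = "orbit (ccw D \<circ> mate D)"
    let ?p = "\<lambda>(\<psi> :: dart set \<Rightarrow> 'k) d. if d \<in> A then \<psi> (?o d) else 0"
    have "inj_on ?p (supported (faces D))"
    proof (rule inj_onI, rule ext)
      fix \<psi> \<psi>' :: "dart set \<Rightarrow> 'k" and F
      assume *: "\<psi> \<in> supported (faces D)" "\<psi>' \<in> supported (faces D)" "?p \<psi> = ?p \<psi>'"
      show "\<psi> F = \<psi>' F"
      proof (cases "F \<in> faces D")
        case True
        then obtain d where "d \<in> A" "F = ?o d" by (auto simp: faces_def A_def)
        then show ?thesis using fun_cong[OF *(3), of d] by simp
      next
        case False
        then show ?thesis using * by (simp add: supported_def)
      qed
    qed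
    moreover have "?p ` supported (faces D) \<subseteq> Y"
    proof -
      have "?o (c (m d)) = ?o d" "c (m d) \<in> A" if "d \<in> A" for d
        using orbit_faces[OF wl, of d] that c m(1) by (simp_all add: A_def m_def c_def)
      then show ?thesis by (auto simp: Y_def supported_def)
    qed
    ultimately show ?thesis
      using card_inj_on_le[of ?p "supported (faces D)" Y] fin card_supported[OF finF, where 'k =
          'k]
      by (simp add: q_def)
  qed

  have Y_le: "card Y \<le> card (cob ` Y) * q"
  proof -
    have "inj_on (\<lambda>f. (cob f, f (0, 0))) Y"
    proof (rule inj_onI)
      fix f g assume fg: "f \<in> Y" "g \<in> Y" "(cob f, f (0, 0)) = (cob g, g (0, 0))"
      let ?h = "\<lambda>d. f d - g d"
      have hc: "?h (c d) = ?h d" if "d \<in> A" for d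
      proof -
        have "cob f d = cob g d" using fg(3) by simp
        then show ?thesis using that by (simp add: cob_def algebra_simps)
      qed
      have hm: "?h (m d) = ?h d" if d: "d \<in> A" for d
      proof -
        have "f (m d) = f (c d)" "g (m d) = g (c d)"
          using fg(1,2) m[OF d] by (force simp: Y_def)+
        then show ?thesis using hc[OF d] by simp
      qed
      have "?h d = ?h (0, 0)" if "d \<in> A" for d
      proof (rule one_component_induct[OF conn, of "(0, 0)" d "\<lambda>d. ?h d = ?h (0, 0)"])
        fix d assume "d \<in> darts D" "?h d = ?h (0, 0)"
        then show "?h (mate D d) = ?h (0, 0)" using hm[of d] by (simp add: A_def m_def)
      next
        fix d assume d: "d \<in> darts D" "?h d = ?h (0, 0)"
        from d(1) show "?h (across D d) = ?h (0, 0)"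
          by (cases rule: across_cases) (use d hc[of d] hc[of "c d"] c[of d] in \<open>simp_all add:
              A_def c_def\<close>)
      qed (use d0 that in \<open>simp_all add: A_def\<close>)
      then have "f d = g d" if "d \<in> A" for d using that fg(3) by simp
      then show "f = g" using fg(1,2) by (fastforce simp: Y_def supported_def)
    qed
    then have "card Y \<le> card ((cob ` Y) \<times> (UNIV :: 'k set))"
      by (rule card_inj_on_le) (use fin in auto)
    then show ?thesis by (simp add: q_def card_cartesian_product)
  qed

  have X_ge: "card Z * card (bd ` X) \<le> card X"
  proof -
    define pick where "pick = inv_into X bd"
    have pick: "pick y \<in> X" "bd (pick y) = y" if "y \<in> bd ` X" for y
      using that by (auto simp: pick_def inv_into_into f_inv_into_f)
    have "inj_on (\<lambda>(z, y) d. z d + pick y d) (Z \<times> bd ` X)"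
    proof (rule inj_onI, clarify)
      fix z z' x x' assume *: "z \<in> Z" "z' \<in> Z" "x \<in> X" "x' \<in> X"
        and eq: "(\<lambda>d. z d + pick (bd x) d) = (\<lambda>d. z' d + pick (bd x') d)"
      have bd: "bd (\<lambda>d. z d + pick (bd x) d) = bd x" if "z \<in> Z" "x \<in> X" for z x
      proof
        fix i
        have "sum z (darts_at D i) = 0" using that(1) by (simp add: Z_def bd_def)
        moreover have "sum (pick (bd x)) (darts_at D i) = bd x i"
          using fun_cong[OF pick(2)[of "bd x"], of i] that(2) by (simp add: bd_def)
        ultimately show "bd (\<lambda>d. z d + pick (bd x) d) i = bd x i"
          by (simp add: bd_def sum.distrib)
      qed
      have x: "bd x = bd x'" using bd[OF *(1,3)] bd[OF *(2,4)] eq by simp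
      then have "z = z'" using eq unfolding x by (simp add: fun_eq_iff)
      with x show "z = z' \<and> bd x = bd x'" by simp
    qed
    moreover have "(\<lambda>(z, y) d. z d + pick y d) ` (Z \<times> bd ` X) \<subseteq> X"
      using pick(1) by (fastforce simp: X_def Z_def supported_def)
    ultimately have "card (Z \<times> bd ` X) \<le> card X"
      using fin by (intro card_inj_on_le)
    then show ?thesis by (simp add: card_cartesian_product)
  qed

  have bd_ge: "q ^ length D \<le> card (bd ` X) * q"
  proof -
    define unit :: "'k \<Rightarrow> nat \<Rightarrow> nat \<Rightarrow> 'k" where "unit a i j = (if j = i then a else 0)" for a i j
    have zero: "(\<lambda>j. 0) \<in> bd ` X"
      by (rule image_eqI[of _ _ "\<lambda>d. 0"]) (auto simp: bd_def X_def supported_def)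
    have add: "(\<lambda>j. y j + y' j) \<in> bd ` X" if y: "y \<in> bd ` X" "y' \<in> bd ` X" for y y'
    proof -
      from y obtain f f' where "f \<in> X" "f' \<in> X" "y = bd f" "y' = bd f'" by blast
      then show ?thesis
        by (intro image_eqI[of _ _ "\<lambda>d. f d + f' d"])
          (auto simp: bd_def sum.distrib X_def supported_def)
    qed
    have edge: "(\<lambda>j. unit a (fst (m d)) j - unit a (fst d) j) \<in> bd ` X" if d: "d \<in> A" for a d
    proof (rule image_eqI)
      let ?f = "\<lambda>e. (if e = m d then a else 0) - (if e = d then a else 0)"
      have "m e = m d \<longleftrightarrow> e = d" "m e = d \<longleftrightarrow> e = m d" if "e \<in> A" for e
        using m(3)[OF that] m(3)[OF d] by metis+
      then show "?f \<in> X" using d m(1)[OF d] by (auto simp: X_def supported_def)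
      show "(\<lambda>j. unit a (fst (m d)) j - unit a (fst d) j) = bd ?f"
        using d m(1)[OF d] by (auto simp: bd_def unit_def sum_subtractf at finA)
    qed
    have path: "\<forall>a. (\<lambda>j. unit a (fst d) j - unit a 0 j) \<in> bd ` X" if "d \<in> A" for d
    proof (rule one_component_induct[OF conn, of "(0, 0)" d "\<lambda>d. \<forall>a. (\<lambda>j. unit a (fst d) j - unit
        a 0 j) \<in> bd ` X"])
      fix d assume d: "d \<in> darts D" "\<forall>a. (\<lambda>j. unit a (fst d) j - unit a 0 j) \<in> bd ` X"
      show "\<forall>a. (\<lambda>j. unit a (fst (mate D d)) j - unit a 0 j) \<in> bd ` X"
      proof
        fix a
        show "(\<lambda>j. unit a (fst (mate D d)) j - unit a 0 j) \<in> bd ` X"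
          using add[OF d(2)[rule_format, of a] edge[of d a]] d(1) by (simp add: A_def m_def)
      qed
    qed (use d0 that zero in \<open>simp_all add: A_def\<close>)
    have unit_mem: "(\<lambda>j. unit a i j - unit a 0 j) \<in> bd ` X" if "i < length D" for a i
    proof -
      have "(i, 0) \<in> A" using that by (cases "D ! i") (auto simp: A_def darts_def)
      from path[OF this] show ?thesis by simp
    qed
    have sum_mem: "(\<lambda>j. \<Sum>i\<in>S. unit (v i) i j - unit (v i) 0 j) \<in> bd ` X"
      if "finite S" "S \<subseteq> {..<length D}" for S v
      using that
    proof (induction S rule: finite_induct)
      case (insert i S)
      then show ?case using add[OF unit_mem[of i "v i"]] by simp
    qed (simp add: zero)
    let ?V = "{..<length D}"
    let ?\<phi> = "\<lambda>v. ((\<lambda>j. v j - unit (sum v ?V) 0 j), sum v ?V)"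
    have "inj_on ?\<phi> (supported ?V)"
      by (rule inj_onI) (auto simp: fun_eq_iff)
    moreover have "?\<phi> ` supported ?V \<subseteq> bd ` X \<times> UNIV"
    proof -
      have "(\<lambda>j. v j - unit (sum v ?V) 0 j) \<in> bd ` X" if v: "v \<in> supported ?V" for v
      proof -
        have "(\<Sum>i\<in>?V. unit (v i) i j - unit (v i) 0 j) = v j - unit (sum v ?V) 0 j" for j
          using v by (simp add: unit_def sum_subtractf supported_def)
        then show ?thesis using sum_mem[of ?V v] by simp
      qed
      then show ?thesis by auto
    qed
    ultimately have "card (supported ?V :: (nat \<Rightarrow> 'k) set) \<le> card (bd ` X \<times> (UNIV :: 'k set))"
      using fin by (intro card_inj_on_le) auto
    then show ?thesis by (simp add: card_supported q_def card_cartesian_product)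
  qed

  have "card Z \<le> card (cob ` Y)"
  proof -
    have E: "card (faces D) + length D = card {d \<in> A. out d} + 2"
      using planar card_O by (simp add: planar_def A_def)
    have bd_pos: "card (bd ` X) > 0"
      using bd_ge q by (metis mult_0 neq0_conv not_le zero_less_power)
    have "card Z * card (bd ` X) * q\<^sup>2 \<le> q ^ card {d \<in> A. out d} * q\<^sup>2"
      using X_ge X_le by (meson le_trans mult_le_mono1)
    also have "\<dots> = q ^ card (faces D) * q ^ length D"
      using E by (simp flip: power_add)
    also have "\<dots> \<le> (card (cob ` Y) * q) * (card (bd ` X) * q)"
      using Y_ge Y_le bd_ge by (meson le_trans mult_le_mono)
    finally have "card Z * (card (bd ` X) * q\<^sup>2) \<le> card (cob ` Y) * (card (bd ` X) * q\<^sup>2)"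
      by (simp add: power2_eq_square mult_ac)
    then show ?thesis using bd_pos q by simp
  qed
  then have "cob ` Y = Z" using cob_Z finZ by (intro card_seteq) auto
  moreover have "(\<lambda>d. if d \<in> A then \<delta> d else 0) \<in> Z"
  proof -
    have "sum (\<lambda>d. if d \<in> A then \<delta> d else 0) (darts_at D i) = 0" for i
    proof (cases "i < length D")
      case True
      have "sum (\<lambda>d. if d \<in> A then \<delta> d else 0) (darts_at D i) = sum \<delta> (darts_at D i)"
        by (rule sum.cong) (auto simp: at)
      then show ?thesis using closed[OF True] by simp
    next
      case False
      then have "darts_at D i = {}" by (auto simp: darts_at_def darts_def)
      then show ?thesis by simp
    qed
    then show ?thesis using anti m by (simp add: Z_def X_def supported_def bd_def A_def m_def)
  qed
  ultimately obtain \<Phi> where \<Phi>: "\<Phi> \<in> Y" "cob \<Phi> = (\<lambda>d. if d \<in> A then \<delta> d else 0)"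
    by (metis (no_types, lifting) imageE)
  show ?thesis
  proof (rule that[of \<Phi>])
    fix d assume d: "d \<in> darts D"
    show "\<Phi> (ccw D (mate D d)) = \<Phi> d" using \<Phi>(1) d by (simp add: Y_def A_def m_def c_def)
    show "\<delta> d = \<Phi> (ccw D d) - \<Phi> d"
      using fun_cong[OF \<Phi>(2), of d] d by (simp add: cob_def A_def c_def)
  qed
qed

section \<open>Crossings and bigons seen from a dart\<close>

lemma crossing_darts:
  assumes "i < length D" "is_crossing (D ! i)" "fst x = i" "x \<in> darts D"
  shows "darts_at D i = {x, ccw D x, ccw D (ccw D x), ccw D (ccw D (ccw D x))}"
    and "distinct [x, ccw D x, ccw D (ccw D x), ccw D (ccw D (ccw D x))]"
    and "ccw D (ccw D (ccw D (ccw D x))) = x"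
    and "across D x = ccw D (ccw D x)"
    and "over (ccw D x) \<longleftrightarrow> \<not> over x"
proof -
  obtain a b c d where v: "D ! i = Crossing a b c d" using assms(2) by (cases "D ! i") auto
  obtain k where x: "x = (i, k)" "k < 4" using assms(3,4) v by (cases x) (auto simp: darts_def)
  have "k \<in> {0, 1, 2, 3}" using x(2) by auto
  then show "darts_at D i = {x, ccw D x, ccw D (ccw D x), ccw D (ccw D (ccw D x))}"
    and "distinct [x, ccw D x, ccw D (ccw D x), ccw D (ccw D (ccw D x))]"
    and "ccw D (ccw D (ccw D (ccw D x))) = x"
    and "across D x = ccw D (ccw D x)"
    and "over (ccw D x) \<longleftrightarrow> \<not> over x"
    by (auto simp: darts_at_Crossing[OF assms(1) v] x v ccw_def across_def over_def)
qed

lemma fox_dart: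
  assumes "i < length D" "is_crossing (D ! i)" "fst x = i" "x \<in> darts D" "fox f (D ! i)"
  shows "f (label D (across D x)) =
    (if over x then f (label D x) else 2 * f (label D (ccw D x)) - f (label D x))"
proof -
  obtain a b c d where v: "D ! i = Crossing a b c d" using assms(2) by (cases "D ! i") auto
  obtain k where x: "x = (i, k)" "k < 4" using assms(3,4) v by (cases x) (auto simp: darts_def)
  have "k \<in> {0, 1, 2, 3}" using x(2) by auto
  then show ?thesis
    using assms(5) by (auto simp: x v across_def ccw_def over_def label_def fox_at_def)
qed

abbreviation sg :: "bool \<Rightarrow> int" where
  "sg b \<equiv> (if b then 1 else - 1)"

text \<open>
  After a half turn of the crossing the upper strand has the opposite sign and the other lower
  edge lies to its right, so the equation may be read off from either end of the upper strand.
\<close>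

lemma lift_dart:
  fixes f g :: "nat \<Rightarrow> 'k::comm_ring_1"
  assumes "i < length D" "is_crossing (D ! i)" "fst x = i" "x \<in> darts D" "fox f (D ! i)"
    and out: "orientation D out" and "over x"
    and "g (label D (across D x)) = g (label D x)"
    and "g (label D (ccw D x)) + g (label D (ccw D (ccw D (ccw D x)))) =
      2 * g (label D x) - of_int (sg (out x)) * 2 * (f (label D (ccw D x)) - f (label D x))"
  shows "lift f g (D ! i, u, sg (out (i, 3)))"
proof -
  obtain a b c d where v: "D ! i = Crossing a b c d" using assms(2) by (cases "D ! i") auto
  obtain k where x: "x = (i, k)" "k < 4" using assms(3,4) v by (cases x) (auto simp: darts_def)
  have "k \<in> {0, 1, 2, 3}" using x(2) by auto
  then have "k = 1 \<or> k = 3" using \<open>over x\<close> by (auto simp: over_def x(1))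
  then show ?thesis
  proof
    assume k: "k = 1"
    have "(i, 1) \<in> darts D" using assms(4) x(1) k by simp
    then have "out (i, 3) \<longleftrightarrow> \<not> out (i, 1)"
      using out v by (force simp: orientation_def across_def)
    then show ?thesis using assms(5,8,9)
      by (auto simp: v x k across_def ccw_def label_def lift_at_def fox_at_def algebra_simps)
  next
    assume k: "k = 3"
    have f: "f b = f d" "f c = 2 * f d - f a"
      using assms(5) by (simp_all add: v fox_at_def)
    have "g d = g b" "g a + g c = 2 * g d - of_int (sg (out x)) * 2 * (f a - f d)"
      using assms(8,9) by (simp_all add: v x k across_def ccw_def label_def)
    then have "g d = g b" "g c = 2 * g d - of_int (sg (out x)) * 2 * (f a - f d) - g a"
      by (simp_all add: eq_diff_eq add.commute)
    then show ?thesis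
      by (simp add: v x k lift_at_def f algebra_simps)
  qed
qed

lemma oriented_decoration:
  assumes D: "well_labelled D" and out: "orientation D out"
  defines "W \<equiv> map (\<lambda>i. (D ! i, sg (out (i, length (ends (D ! i)) div 2)), sg (out (i, 3))))
      [0..<length D]"
  shows "map fst W = D" "signed W" "total_flow W l = 0"
proof -
  show "map fst W = D" by (simp add: W_def comp_def map_nth)
  show "signed W" by (auto simp: W_def signed_def)
  have outa: "out (across D d) \<longleftrightarrow> \<not> out d" if "d \<in> darts D" for d
    using out that by (auto simp: orientation_def)
  have flow: "flow (D ! i, sg (out (i, length (ends (D ! i)) div 2)), sg (out (i, 3))) l =
      (\<Sum>d\<in>darts_at D i. if label D d = l then sg (out d) else 0)" if i: "i < length D" for i
  proof (cases "D ! i")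
    case (Crossing a b c d)
    have "(i, 0) \<in> darts D" "(i, 1) \<in> darts D" using i Crossing by (auto simp: darts_def)
    from outa[OF this(1)] outa[OF this(2)]
    have *: "out (i, Suc (Suc 0)) \<longleftrightarrow> \<not> out (i, 0)" "out (i, 3) \<longleftrightarrow> \<not> out (i, 1)"
      by (simp_all add: across_def Crossing)
    then have "out (i, 2) \<longleftrightarrow> \<not> out (i, 0)" by (simp only: numeral_2_eq_2)
    with * show ?thesis
      by (simp add: Crossing darts_at_Crossing[OF i Crossing] label_def)
  next
    case (Point a b)
    have "(i, 0) \<in> darts D" using i Point by (auto simp: darts_def)
    from outa[OF this] have "out (i, 1) \<longleftrightarrow> \<not> out (i, 0)"
      by (simp add: across_def Point)
    then show ?thesis
      by (simp add: Point darts_at_Point[OF i Point] label_def)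
  qed
  let ?S = "{d \<in> darts D. label D d = l}"
  have "total_flow W l = (\<Sum>i<length D. \<Sum>d\<in>darts_at D i. if label D d = l then sg (out d) else 0)"
    using flow by (simp add: total_flow_def W_def comp_def interv_sum_list_conv_sum_set_nat
        atLeast0LessThan)
  also have "\<dots> = (\<Sum>d\<in>(\<Union>i<length D. darts_at D i). if label D d = l then sg (out d) else 0)"
    by (rule sum.UNION_disjoint[symmetric]) (auto simp: darts_at_def finite_darts)
  also have "(\<Union>i<length D. darts_at D i) = darts D"
    by (auto simp: darts_at_def darts_def)
  also have "(\<Sum>d\<in>darts D. if label D d = l then sg (out d) else 0) = (\<Sum>d\<in>?S. sg (out d))"
    by (rule sum.inter_filter[symmetric, OF finite_darts])
  finally have eq: "total_flow W l = (\<Sum>d\<in>?S. sg (out d))" .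
  have "bij_betw (mate D) ?S ?S"
    by (rule bij_betw_byWitness[of _ "mate D"]) (use mate[OF D] in auto)
  then have "(\<Sum>d\<in>?S. sg (out d)) = (\<Sum>d\<in>?S. sg (out (mate D d)))"
    by (rule sum.reindex_bij_betw[symmetric])
  also have "\<dots> = (\<Sum>d\<in>?S. - sg (out d))"
    by (rule sum.cong) (use out in \<open>auto simp: orientation_def\<close>)
  also have "\<dots> = - (\<Sum>d\<in>?S. sg (out d))" by (rule sum_negf)
  finally show "total_flow W l = 0" using eq by linarith
qed

text \<open>
  At each crossing of a matched diagram, \<open>Q\<close> contains the dart \<open>x\<close> for which \<open>x\<close> and \<open>ccw D x\<close>
  are the two sides of the bigon. The other crossing of the pair has \<open>mate D (ccw D x)\<close> in this
  role, and the conditions are symmetric under this exchange.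
\<close>

definition bigon_darts :: "diagram \<Rightarrow> (dart \<Rightarrow> bool) \<Rightarrow> dart set \<Rightarrow> bool" where
  "bigon_darts D out Q \<longleftrightarrow> Q \<subseteq> darts D \<and>
     (\<forall>x\<in>Q. is_crossing (D ! fst x) \<and> mate D (ccw D x) \<in> Q \<and>
        mate D x = ccw D (mate D (ccw D x)) \<and> over (mate D x) \<noteq> over x \<and> out (ccw D x) \<noteq> out x) \<and>
     (\<forall>i<length D. is_crossing (D ! i) \<longrightarrow> (\<exists>!x. x \<in> Q \<and> fst x = i))"

lemma matched_bigons:
  assumes D: "well_labelled D" and "matched D"
  obtains out Q where "orientation D out" "bigon_darts D out Q"
proof -
  from \<open>matched D\<close> obtain out P where *: "orientation D out \<and>
      partition_on {i. i < length D \<and> is_crossing (D ! i)} P \<and>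
      (\<forall>B\<in>P. \<exists>i j. B = {i, j} \<and> matched_pair D out i j)"
    unfolding matched_def by (elim exE) (rule that)
  note out = *[THEN conjunct1] and P = *[THEN conjunct2, THEN conjunct1]
    and pairs = *[THEN conjunct2, THEN conjunct2, THEN bspec]
  define R where "R B p q' \<longleftrightarrow> B = {fst p, fst q'} \<and> {p, q', ccw D p, ccw D q'} \<subseteq> darts D \<and>
      fst p \<noteq> fst q' \<and> is_crossing (D ! fst p) \<and> is_crossing (D ! fst q') \<and>
      mate D p = ccw D q' \<and> mate D (ccw D p) = q' \<and> over p \<noteq> over (ccw D q') \<and>
      over (ccw D p) \<noteq> over q' \<and> out p \<noteq> out (ccw D p)" for B p q'
  have ex: "\<exists>p q'. R B p q'" if "B \<in> P" for B
  proof -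
    from pairs[OF that] obtain i j where B: "B = {i, j}" "matched_pair D out i j" by blast
    from B(2) obtain p q p' q' where "{p, q, p', q'} \<subseteq> darts D" "fst p = i" "fst q' = j"
      "q = ccw D p" "p' = ccw D q'" "mate D p = p'" "mate D q = q'"
      "over p \<noteq> over p'" "over q \<noteq> over q'" "out p \<noteq> out q"
      "i \<noteq> j" "is_crossing (D ! i)" "is_crossing (D ! j)"
      unfolding matched_pair_def by (elim conjE exE) (rule that)
    then have "R B p q'" using B(1) unfolding R_def by simp
    then show ?thesis by blast
  qed
  define p where "p B = (SOME p. \<exists>q'. R B p q')" for B
  define q where "q B = (SOME q'. R B (p B) q')" for B
  have R: "R B (p B) (q B)" if "B \<in> P" for B
    unfolding q_def p_def by (rule someI_ex, rule someI_ex, rule ex[OF that])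
  define Q where "Q = p ` P \<union> q ` P"
  have outm: "out (mate D d) \<longleftrightarrow> \<not> out d" if "d \<in> darts D" for d
    using out that by (auto simp: orientation_def)
  have fst_Q: "fst (p B) \<in> B" "fst (q B) \<in> B" if "B \<in> P" for B
    using R[OF that] by (auto simp: R_def)
  have "x \<in> darts D \<and> is_crossing (D ! fst x) \<and> mate D (ccw D x) \<in> Q \<and>
        mate D x = ccw D (mate D (ccw D x)) \<and> over (mate D x) \<noteq> over x \<and> out (ccw D x) \<noteq> out x"
    if "x \<in> Q" for x
  proof -
    from that obtain B where B: "B \<in> P" "x = p B \<or> x = q B" by (auto simp: Q_def)
    note r = R[OF B(1), unfolded R_def]
    have d: "p B \<in> darts D" "q B \<in> darts D" "ccw D (p B) \<in> darts D" using r by auto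
    have bk: "mate D (ccw D (q B)) = p B" "mate D (q B) = ccw D (p B)"
      using mate(4)[OF D d(1)] mate(4)[OF D d(3)] r by simp_all
    have in_Q: "p B \<in> Q" "q B \<in> Q" using B(1) by (auto simp: Q_def)
    from B(2) show ?thesis
    proof
      assume "x = p B"
      then show ?thesis using r in_Q by auto
    next
      assume "x = q B"
      then show ?thesis using r in_Q bk outm[OF d(1)] outm[OF d(3)] by auto
    qed
  qed
  moreover have "\<exists>!x. x \<in> Q \<and> fst x = i" if i: "i < length D" "is_crossing (D ! i)" for i
  proof -
    obtain B where B: "B \<in> P" "i \<in> B" using i P by (auto simp: partition_on_def)
    have uniq: "B' = B" if "B' \<in> P" "i \<in> B'" for B'
      using P B that unfolding partition_on_def disjoint_def by blast
    show ?thesis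
    proof (rule ex_ex1I)
      have "i = fst (p B) \<or> i = fst (q B)" using R[OF B(1)] B(2) unfolding R_def by blast
      then show "\<exists>x. x \<in> Q \<and> fst x = i" using B(1) unfolding Q_def by blast
    next
      have in_B: "z \<in> {p B, q B}" if z: "z \<in> Q \<and> fst z = i" for z
      proof -
        from z obtain B' where B': "B' \<in> P" "z = p B' \<or> z = q B'" unfolding Q_def by blast
        then have "i \<in> B'" using fst_Q z by metis
        with B' uniq show ?thesis by blast
      qed
      fix x y assume *: "x \<in> Q \<and> fst x = i" "y \<in> Q \<and> fst y = i"
      have "fst (p B) \<noteq> fst (q B)" using R[OF B(1)] by (simp add: R_def)
      then show "x = y" using in_B[OF *(1)] in_B[OF *(2)] * by auto
    qed
  qed
  ultimately have "bigon_darts D out Q" unfolding bigon_darts_def by blast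
  with out show ?thesis by (rule that)
qed

section \<open>Matched diagrams\<close>

text \<open>
  In the proof, \<open>s d\<close> is the value of the Fox colouring on the edge of \<open>d\<close>, counted positively
  if the knot leaves along \<open>d\<close>. The sum of \<open>s\<close> at a crossing is the jump of the lower strand,
  which need not vanish. The function \<open>\<delta>\<close> exchanges the two values on the sides of each bigon.
  It is closed: let \<open>F\<close> and \<open>H\<close> be the values on the sides of the bigon that pass over and under
  at the crossing. The other two edges there have the values \<open>F\<close> and \<open>2 * F - H\<close>. After the
  exchange the value increases by \<open>F - H\<close> along both strands if both are followed away from the
  bigon; but one of them runs towards it, as the sides of a bigon are counter-directed. The lift
  \<open>g\<close> is the value of the potential \<open>\<Phi>\<close> of \<open>\<delta>\<close> on the left of the oriented edge, except on the
  sides of the bigons, which belong to the matched pairs and not to the untwisted curve. There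
  \<open>g\<close> is dictated by the end at which the strand passes over.
\<close>

lemma matched_liftable:
  assumes knot: "knot_diagram D" and "matched D"
  shows "liftable TYPE('k::{finite, comm_ring_1}) D"
proof -
  have wl: "well_labelled D" using knot by (simp add: knot_diagram_def)
  obtain out Q where out: "orientation D out" and Q: "bigon_darts D out Q"
    by (rule matched_bigons[OF wl \<open>matched D\<close>])
  let ?W = "map (\<lambda>i. (D ! i, sg (out (i, length (ends (D ! i)) div 2)), sg (out (i, 3))))
      [0..<length D]"
  note mate = mate[OF wl]
  have outm: "out (mate D d) \<longleftrightarrow> \<not> out d" and outa: "out (across D d) \<longleftrightarrow> \<not> out d"
    if "d \<in> darts D" for d
    using out that by (auto simp: orientation_def)
  have QD: "x \<in> darts D" "fst x < length D" "is_crossing (D ! fst x)" "ccw D x \<in> darts D"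
    "mate D (ccw D x) \<in> Q" "mate D x = ccw D (mate D (ccw D x))"
    "over (mate D x) \<longleftrightarrow> \<not> over x" "out (ccw D x) \<longleftrightarrow> \<not> out x" if x: "x \<in> Q" for x
  proof -
    show d: "x \<in> darts D" using Q x unfolding bigon_darts_def by blast
    show "fst x < length D" using d by (auto simp: darts_def)
    show "ccw D x \<in> darts D" using darts_ccw[OF d] .
    have B: "is_crossing (D ! fst x) \<and> mate D (ccw D x) \<in> Q \<and>
        mate D x = ccw D (mate D (ccw D x)) \<and> over (mate D x) \<noteq> over x \<and> out (ccw D x) \<noteq> out x"
      using Q x unfolding bigon_darts_def by blast
    then show "is_crossing (D ! fst x)" "mate D (ccw D x) \<in> Q"
      "mate D x = ccw D (mate D (ccw D x))"
      "over (mate D x) \<longleftrightarrow> \<not> over x" "out (ccw D x) \<longleftrightarrow> \<not> out x"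
      by blast+
  qed
  have Q_unique: "y = x" if "x \<in> Q" "y \<in> Q" "fst y = fst x" for x y
    using Q that QD unfolding bigon_darts_def by metis
  have Q_at: "\<exists>x\<in>Q. fst x = i" if "i < length D" "is_crossing (D ! i)" for i
    using Q that unfolding bigon_darts_def by blast
  have around: "darts_at D (fst x) = {x, ccw D x, ccw D (ccw D x), ccw D (ccw D (ccw D x))}"
    "distinct [x, ccw D x, ccw D (ccw D x), ccw D (ccw D (ccw D x))]"
    "ccw D (ccw D (ccw D (ccw D x))) = x" "across D x = ccw D (ccw D x)"
    "over (ccw D x) \<longleftrightarrow> \<not> over x" if x: "x \<in> Q" for x
    by (rule crossing_darts[OF QD(2,3)[OF x] refl QD(1)[OF x]])+
  have notin_Q: "ccw D x \<notin> Q" "ccw D (ccw D x) \<notin> Q" "ccw D (ccw D (ccw D x)) \<notin> Q"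
    if x: "x \<in> Q" for x
    using Q_unique[OF x, of "ccw D x"] Q_unique[OF x, of "ccw D (ccw D x)"]
      Q_unique[OF x, of "ccw D (ccw D (ccw D x))"] around(2)[OF x] by auto
  have notin_cQ: "x \<notin> ccw D ` Q" "ccw D (ccw D x) \<notin> ccw D ` Q" "ccw D (ccw D (ccw D x)) \<notin> ccw D `
      Q"
    if x: "x \<in> Q" for x
  proof -
    have *: "z \<notin> ccw D ` Q" if "fst z = fst x" "z \<noteq> ccw D x" for z
    proof
      assume "z \<in> ccw D ` Q"
      then obtain y where y: "y \<in> Q" "z = ccw D y" by blast
      then have "y = x" using Q_unique[OF x y(1)] that(1) by simp
      then show False using y(2) that(2) by simp
    qed
    have n: "x \<noteq> ccw D x" "ccw D (ccw D x) \<noteq> ccw D x" "ccw D (ccw D (ccw D x)) \<noteq> ccw D x"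
      using around(2)[OF x] by auto
    show "x \<notin> ccw D ` Q" by (rule *) (simp_all add: n)
    show "ccw D (ccw D x) \<notin> ccw D ` Q" by (rule *) (simp_all add: n)
    show "ccw D (ccw D (ccw D x)) \<notin> ccw D ` Q" by (rule *) (simp_all add: n)
  qed
  have closed_Q: "mate D d \<in> Q \<union> ccw D ` Q" if "d \<in> Q \<union> ccw D ` Q" for d
    using that
  proof
    assume "d \<in> Q"
    then have "mate D (ccw D d) \<in> Q" "mate D d = ccw D (mate D (ccw D d))" by (rule QD)+
    then show ?thesis by blast
  next
    assume "d \<in> ccw D ` Q"
    then show ?thesis using QD(5) by blast
  qed
  have point_notin: "(i, k) \<notin> Q" "(i, k) \<notin> ccw D ` Q" if "i < length D" "D ! i = Point a b" for i
      k a b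
  proof -
    have *: "fst x \<noteq> i" if "x \<in> Q" for x using QD(3)[OF that] \<open>D ! i = Point a b\<close> by auto
    then show "(i, k) \<notin> Q" by force
    show "(i, k) \<notin> ccw D ` Q"
    proof
      assume "(i, k) \<in> ccw D ` Q"
      then obtain x where x: "x \<in> Q" "(i, k) = ccw D x" by blast
      then have "fst x = i" using fst_ccw[of D x] by (simp flip: x(2))
      then show False using *[OF x(1)] by simp
    qed
  qed

  have "\<exists>g. \<forall>t\<in>set ?W. lift f g t" if f: "\<forall>v\<in>set D. fox f v" for f :: "nat \<Rightarrow> 'k"
  proof -
    define s where "s d = (if out d then f (label D d) else - f (label D d))" for d
    define \<delta> where "\<delta> d = (if d \<in> Q then - s (ccw D d)
      else if d \<in> ccw D ` Q then - s (ccw D (ccw D (ccw D d))) else s d)" for d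
    have sm: "s (mate D d) = - s d" if "d \<in> darts D" for d
      using that by (simp add: s_def mate outm)
    have \<delta>: "\<delta> x = - s (ccw D x)" "\<delta> (ccw D x) = - s x"
      "\<delta> (ccw D (ccw D x)) = s (ccw D (ccw D x))"
      "\<delta> (ccw D (ccw D (ccw D x))) = s (ccw D (ccw D (ccw D x)))" if x: "x \<in> Q" for x
      using x notin_Q[OF x] notin_cQ[OF x] around(3)[OF x] by (simp_all add: \<delta>_def)
    have f_at: "fox f (D ! i)" if "i < length D" for i using f that by simp
    have outs: "out (ccw D (ccw D x)) \<longleftrightarrow> \<not> out x" "out (ccw D (ccw D (ccw D x))) \<longleftrightarrow> out x"
      and overs: "over (ccw D x) \<longleftrightarrow> \<not> over x"
      and ac: "across D x = ccw D (ccw D x)" "across D (ccw D x) = ccw D (ccw D (ccw D x))"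
      and fs: "f (label D (ccw D (ccw D x))) =
          (if over x then f (label D x) else 2 * f (label D (ccw D x)) - f (label D x))"
        "f (label D (ccw D (ccw D (ccw D x)))) =
          (if over x then 2 * f (label D x) - f (label D (ccw D x)) else f (label D (ccw D x)))"
      if x: "x \<in> Q" for x
    proof -
      have q: "ccw D x \<in> darts D" "fst (ccw D x) = fst x" using QD(4)[OF x] by simp_all
      note a = around[OF x] and a' = crossing_darts[OF QD(2,3)[OF x] q(2,1)]
      show 1: "across D x = ccw D (ccw D x)" "across D (ccw D x) = ccw D (ccw D (ccw D x))"
        "over (ccw D x) \<longleftrightarrow> \<not> over x"
        using a(4,5) a'(4) by simp_all
      then show "out (ccw D (ccw D x)) \<longleftrightarrow> \<not> out x" "out (ccw D (ccw D (ccw D x))) \<longleftrightarrow> out x"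
        using outa[OF QD(1)[OF x]] outa[OF q(1)] QD(8)[OF x] by simp_all
      have "fox f (D ! fst x)" using f QD(2)[OF x] by simp
      note fd = fox_dart[OF QD(2,3)[OF x] refl QD(1)[OF x] this]
        fox_dart[OF QD(2,3)[OF x] q(2,1) this]
      then show "f (label D (ccw D (ccw D x))) =
          (if over x then f (label D x) else 2 * f (label D (ccw D x)) - f (label D x))"
        "f (label D (ccw D (ccw D (ccw D x)))) =
          (if over x then 2 * f (label D x) - f (label D (ccw D x)) else f (label D (ccw D x)))"
        using 1 by simp_all
    qed

    have anti: "\<delta> (mate D d) = - \<delta> d" if d: "d \<in> darts D" for d
    proof -
      consider "d \<in> Q" | x where "x \<in> Q" "d = ccw D x" | "d \<notin> Q" "d \<notin> ccw D ` Q" by blast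
      then show ?thesis
      proof cases
        case 1
        have "\<delta> (mate D d) = - s (mate D (ccw D d))"
          unfolding QD(6)[OF 1] by (rule \<delta>(2)[OF QD(5)[OF 1]])
        then show ?thesis using 1 \<delta>(1)[OF 1] sm QD(4) by simp
      next
        case 2
        have "\<delta> (mate D d) = - s (mate D x)"
          using \<delta>(1)[OF QD(5)[OF 2(1)]] QD(6)[OF 2(1)] 2(2) by simp
        then show ?thesis using 2 \<delta>(2)[OF 2(1)] sm QD(1) by simp
      next
        case 3
        have "mate D d \<notin> Q \<union> ccw D ` Q" using 3 closed_Q[of "mate D d"] mate(4)[OF d] by auto
        then show ?thesis using 3 sm[OF d] by (simp add: \<delta>_def)
      qed
    qed
    have closed: "sum \<delta> (darts_at D i) = 0" if i: "i < length D" for i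
      proof (cases "is_crossing (D ! i)")
        case True
        then obtain x where x: "x \<in> Q" "fst x = i" using Q_at i by blast
        note a = around[OF x(1)]
        have "sum \<delta> (darts_at D i) = \<delta> x + \<delta> (ccw D x) + \<delta> (ccw D (ccw D x)) +
            \<delta> (ccw D (ccw D (ccw D x)))"
          using a(1,2) x(2) by (simp add: add.assoc)
        also have "\<dots> = 0"
          using \<delta>[OF x(1)] outs[OF x(1)] fs[OF x(1)] QD(8)[OF x(1)] by (simp add: s_def)
        finally show ?thesis .
      next
        case False
        then obtain a b where v: "D ! i = Point a b" by (cases "D ! i") auto
        have "(i, 0) \<in> darts D" using i v by (simp add: darts_def)
        from outa[OF this] have "out (i, 1) \<longleftrightarrow> \<not> out (i, 0)" by (simp add: across_def v)
        moreover have "f a = f b" using f_at[OF i] by (simp add: v)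
        ultimately show ?thesis
          by (simp add: darts_at_Point[OF i v] \<delta>_def point_notin[OF i v] s_def label_def v)
    qed
    obtain \<Phi> where \<Phi>: "\<And>d. d \<in> darts D \<Longrightarrow> \<Phi> (ccw D (mate D d)) = \<Phi> d"
      "\<And>d. d \<in> darts D \<Longrightarrow> \<delta> d = \<Phi> (ccw D d) - \<Phi> d"
      by (rule closed_imp_face_potential[OF knot out, of \<delta>]) (rule anti, assumption, rule closed,
          assumption, rule that)

    \<comment> \<open>the potential on the left of the oriented edge of \<open>d\<close>\<close>
    define G where "G d = (if out d then \<Phi> (ccw D d) else \<Phi> d)" for d
    define G' where "G' d = (if d \<in> Q \<union> ccw D ` Q
      then if over d then G (across D d) else G (across D (mate D d)) else G d)" for d
    define g where "g l = G' (SOME d. d \<in> darts D \<and> label D d = l)" for l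
    have Gm: "G (mate D d) = G d" if d: "d \<in> darts D" for d
      using \<Phi>(1)[OF d] \<Phi>(1)[OF mate(1)[OF d]] outm[OF d] mate(4)[OF d] by (simp add: G_def)
    have G'm: "G' (mate D d) = G' d" if d: "d \<in> darts D" for d
    proof (cases "d \<in> Q \<union> ccw D ` Q")
      case True
      then have "over (mate D d) \<longleftrightarrow> \<not> over d"
      proof
        assume "d \<in> Q"
        then show ?thesis by (rule QD(7))
      next
        assume "d \<in> ccw D ` Q"
        then have "mate D d \<in> Q" using QD(5) by blast
        from QD(7)[OF this] show ?thesis unfolding mate(4)[OF d] by blast
      qed
      with closed_Q[OF True] show ?thesis using True mate(4)[OF d] by (simp add: G'_def)
    next
      case False
      then have "mate D d \<notin> Q \<union> ccw D ` Q"
        using closed_Q[of "mate D d"] unfolding mate(4)[OF d] by blast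
      then show ?thesis using False Gm[OF d] by (simp add: G'_def)
    qed
    have gl: "g (label D d) = G' d" if d: "d \<in> darts D" for d
    proof -
      define e where "e = (SOME e. e \<in> darts D \<and> label D e = label D d)"
      have e: "e \<in> darts D \<and> label D e = label D d"
        unfolding e_def by (rule someI[of _ d]) (use d in simp)
      then have "e = d \<or> e = mate D d" using mate_unique[OF wl d, of e] by blast
      then show ?thesis using G'm[OF d] by (auto simp: g_def e_def)
    qed
    have g: "g (label D x) = (if over x then G (ccw D (ccw D x))
          else G (ccw D (ccw D (ccw D (mate D (ccw D x))))))"
        "g (label D (ccw D x)) = (if over x then G (ccw D (ccw D (mate D (ccw D x))))
          else G (ccw D (ccw D (ccw D x))))"
        "g (label D (ccw D (ccw D x))) = G (ccw D (ccw D x))"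
        "g (label D (ccw D (ccw D (ccw D x)))) = G (ccw D (ccw D (ccw D x)))" if x: "x \<in> Q" for x
    proof -
      let ?y = "mate D (ccw D x)"
      have "G' x = (if over x then G (across D x) else G (across D (ccw D ?y)))"
        using x QD(6)[OF x] by (simp add: G'_def)
      then show "g (label D x) = (if over x then G (ccw D (ccw D x)) else G (ccw D (ccw D (ccw D
          ?y))))"
        using ac[OF x] ac[OF QD(5)[OF x]] gl[OF QD(1)[OF x]] by simp
      have "G' (ccw D x) = (if over x then G (across D ?y) else G (across D (ccw D x)))"
        using x overs[OF x] by (simp add: G'_def)
      then show "g (label D (ccw D x)) = (if over x then G (ccw D (ccw D ?y))
          else G (ccw D (ccw D (ccw D x))))"
        using ac[OF x] ac[OF QD(5)[OF x]] gl[OF QD(4)[OF x]] by simp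
      show "g (label D (ccw D (ccw D x))) = G (ccw D (ccw D x))"
        "g (label D (ccw D (ccw D (ccw D x)))) = G (ccw D (ccw D (ccw D x)))"
        using gl[OF darts_ccw[OF QD(4)[OF x]]] gl[OF darts_ccw[OF darts_ccw[OF QD(4)[OF x]]]]
          notin_Q[OF x] notin_cQ[OF x] by (simp_all add: G'_def)
    qed
    have \<Phi>_around: "\<Phi> (ccw D x) = \<Phi> x - s (ccw D x)" "\<Phi> (ccw D (ccw D x)) = \<Phi> x - s (ccw D x) - s
        x"
      "\<Phi> (ccw D (ccw D (ccw D x))) = \<Phi> x - s (ccw D (ccw D (ccw D x)))" if x: "x \<in> Q" for x
    proof -
      note d = QD(1)[OF x] QD(4)[OF x] darts_ccw[OF QD(4)[OF x]] darts_ccw[OF darts_ccw[OF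
          QD(4)[OF x]]]
      show "\<Phi> (ccw D x) = \<Phi> x - s (ccw D x)" "\<Phi> (ccw D (ccw D x)) = \<Phi> x - s (ccw D x) - s x"
        "\<Phi> (ccw D (ccw D (ccw D x))) = \<Phi> x - s (ccw D (ccw D (ccw D x)))"
        using \<Phi>(2)[OF d(1)] \<Phi>(2)[OF d(2)] \<Phi>(2)[OF d(4)] \<delta>[OF x] around(3)[OF x]
        by (simp_all add: algebra_simps)
    qed
    have \<Phi>_other: "\<Phi> (mate D (ccw D x)) = \<Phi> (ccw D (ccw D x))" if x: "x \<in> Q" for x
      using \<Phi>(1)[OF QD(1)[OF QD(5)[OF x]]] mate(4)[OF QD(4)[OF x]] by simp

    have "lift f g (D ! i, u, sg (out (i, 3)))" if i: "i < length D" for i u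
    proof (cases "is_crossing (D ! i)")
      case True
      then obtain x where x: "x \<in> Q" "fst x = i" using Q_at i by blast
      let ?y = "mate D (ccw D x)"
      have y: "?y \<in> Q" "ccw D ?y = mate D x" using QD(5,6)[OF x(1)] by simp_all
      have y': "label D ?y = label D (ccw D x)" "label D (ccw D ?y) = label D x"
        "out ?y \<longleftrightarrow> out x" "over ?y \<longleftrightarrow> over x" "out (ccw D ?y) \<longleftrightarrow> \<not> out x"
        using mate(3)[OF QD(4)[OF x(1)]] mate(3)[OF QD(1)[OF x(1)]] outm[OF QD(4)[OF x(1)]]
          QD(8)[OF x(1)] QD(7)[OF y(1)] mate(4)[OF QD(4)[OF x(1)]] overs[OF x(1)] QD(8)[OF y(1)]
        by (simp_all add: y(2))
      note vals = g[OF x(1)] \<Phi>_around[OF x(1)] \<Phi>_around[OF y(1)] \<Phi>_other[OF x(1)]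
        outs[OF x(1)] outs[OF y(1)] fs[OF x(1)] fs[OF y(1)] y' QD(8)[OF x(1)]
        around(3)[OF x(1)] around(3)[OF y(1)]
      show ?thesis
      proof (cases "over x")
        case True
        show ?thesis
        proof (rule lift_dart[OF i \<open>is_crossing (D ! i)\<close> x(2) QD(1)[OF x(1)] f_at[OF i] out True])
          show "g (label D (across D x)) = g (label D x)"
            using vals True by (simp add: ac[OF x(1)])
          show "g (label D (ccw D x)) + g (label D (ccw D (ccw D (ccw D x)))) =
            2 * g (label D x) - of_int (sg (out x)) * 2 * (f (label D (ccw D x)) - f (label D x))"
            using True by (cases "out x") (simp_all add: vals G_def s_def algebra_simps)
        qed
      next
        case False
        have q: "fst (ccw D x) = i" "over (ccw D x)" using x False overs by simp_all
        show ?thesis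
        proof (rule lift_dart[OF i \<open>is_crossing (D ! i)\<close> q(1) QD(4)[OF x(1)] f_at[OF i] out q(2)])
          show "g (label D (across D (ccw D x))) = g (label D (ccw D x))"
            using vals False by (simp add: ac[OF x(1)])
          show "g (label D (ccw D (ccw D x))) + g (label D (ccw D (ccw D (ccw D (ccw D x))))) =
            2 * g (label D (ccw D x)) -
            of_int (sg (out (ccw D x))) * 2 * (f (label D (ccw D (ccw D x))) - f (label D (ccw D
                x)))"
            using False by (cases "out x") (simp_all add: vals G_def s_def algebra_simps)
        qed
      qed
    next
      case False
      then obtain a b where v: "D ! i = Point a b" by (cases "D ! i") auto
      have d: "(i, 0) \<in> darts D" "(i, 1) \<in> darts D" using i v by (simp_all add: darts_def)
      have ccw: "ccw D (i, 0) = (i, 1)" "ccw D (i, 1) = (i, 0)" by (simp_all add: ccw_def v)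
      have "out (i, 1) \<longleftrightarrow> \<not> out (i, 0)" using outa[OF d(1)] by (simp add: across_def v)
      then have "G (i, 0) = G (i, 1)" by (simp add: G_def ccw[unfolded One_nat_def])
      then have "g (label D (i, 0)) = g (label D (i, 1))"
        using gl[OF d(1)] gl[OF d(2)] point_notin[OF i v] by (simp add: G'_def)
      then show ?thesis by (simp add: v label_def)
    qed
    then show ?thesis by (intro exI[of _ g]) auto
  qed
  with oriented_decoration[OF wl out] show ?thesis by (intro liftableI[of ?W])
qed

section \<open>Certificates\<close>

type_synonym weighted_crossing = "nat vertex \<times> int \<times> int \<times> int"

fun crossing_pairing :: "(nat \<Rightarrow> 'k::comm_ring_1) \<Rightarrow> weighted_crossing \<Rightarrow> 'k" where
  "crossing_pairing h (Crossing a b c d, e, m, n) =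
     of_int m * (h c - 2 * h b + h a) + of_int n * (h b - h d)"
| "crossing_pairing h (Point a b, e, m, n) = 0"

fun crossing_jump :: "(nat \<Rightarrow> int) \<Rightarrow> weighted_crossing \<Rightarrow> int" where
  "crossing_jump F (Crossing a b c d, e, m, n) = m * (2 * (F c - F b))"
| "crossing_jump F (Point a b, e, m, n) = 0"

fun numbered_crossing :: "nat \<Rightarrow> weighted_crossing \<Rightarrow> bool" where
  "numbered_crossing N (Crossing a b c d, e, m, n) \<longleftrightarrow>
     a \<in> {1..N} \<and> c = a mod N + 1 \<and>
     (e = 1 \<and> b \<in> {1..N} \<and> d = b mod N + 1 \<or> e = - 1 \<and> d \<in> {1..N} \<and> b = d mod N + 1)"
| "numbered_crossing N (Point a b, e, m, n) \<longleftrightarrow> False"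

fun incoming :: "weighted_crossing \<Rightarrow> nat list" where
  "incoming (Crossing a b c d, e, m, n) = [a, if e = 1 then b else d]"
| "incoming (Point a b, e, m, n) = []"

fun fox_mod :: "int \<Rightarrow> (nat \<Rightarrow> int) \<Rightarrow> weighted_crossing \<Rightarrow> bool" where
  "fox_mod p F (Crossing a b c d, e, m, n) \<longleftrightarrow> p dvd F b - F d \<and> p dvd F c - (2 * F b - F a)"
| "fox_mod p F (Point a b, e, m, n) \<longleftrightarrow> False"

text \<open>
  A certificate consists of a Fox colouring \<open>Fs\<close> modulo \<open>p\<close> and of two weights \<open>m\<close>, \<open>n\<close> for each
  crossing, by which its two equations for \<open>g\<close> are multiplied. The coefficient of every unknown
  in the sum of these equations vanishes modulo \<open>p\<close>, while the right-hand sides add up to \<open>1\<close>.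
  The list \<open>Fs\<close> starts with edge \<open>1\<close>.
\<close>

definition certificate :: "int \<Rightarrow> nat \<Rightarrow> weighted_crossing list \<Rightarrow> int list \<Rightarrow> bool" where
  "certificate p N C Fs \<longleftrightarrow> (let F = (\<lambda>l. Fs ! (l - 1)) in
     N > 0 \<and> C \<noteq> [] \<and> list_all (\<lambda>x. numbered_crossing N x \<and> fox_mod p F x) C \<and>
     distinct (concat (map incoming C)) \<and>
     list_all (\<lambda>l. p dvd (\<Sum>x\<leftarrow>C. crossing_pairing (\<lambda>k. of_bool (k = l)) x)) [1..<Suc N] \<and>
     (\<Sum>(v, e, m, n)\<leftarrow>C. e * crossing_jump F (v, e, m, n)) mod p = 1)"

lemma next_inj: "k \<in> {1..N} \<Longrightarrow> k' \<in> {1..N} \<Longrightarrow> k mod N + 1 = k' mod N + 1 \<longleftrightarrow> k = k'" for N :: nat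
  by (cases "k = N"; cases "k' = N") auto

fun visits :: "weighted_crossing \<times> int \<times> int \<Rightarrow> (nat \<times> int) list" where
  "visits ((Crossing a b c d, e, m, n), u, w) = [(a, u), (if e = 1 then b else d, e * w)]"
| "visits ((Point a b, e, m, n), u, w) = []"

lemma sum_list_of_bool_distinct:
  "distinct (map fst V) \<Longrightarrow> (k, t) \<in> set V \<Longrightarrow> (\<Sum>(k', t')\<leftarrow>V. t' * of_bool (k' = k)) = (t :: int)"
proof (induction V)
  case (Cons x V)
  have zero: "(\<Sum>(k', t')\<leftarrow>V. t' * of_bool (k' = k)) = (0::int)" if "k \<notin> fst ` set V" for k
    using that by (induction V) auto
  show ?case
    using Cons zero[of k] by (cases x) (auto simp: rev_image_eqI)
qed simp

text \<open>
  Each edge leaves one crossing and enters another one. That the flow through it vanishes means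
  that the two strands agree on whether the orientation follows the numbering of the edges. So
  all strands have the same sign \<open>\<sigma>\<close> relative to the numbering, for which \<open>e\<close> is the sign of the
  strand \<open>b d\<close>.
\<close>

lemma numbered_orientation:
  assumes N: "N > 0" and C: "\<forall>x\<in>set C. numbered_crossing N x"
    and dist: "distinct (concat (map incoming C))" and len: "length S = length C"
    and bal: "\<And>l. total_flow (zip (map fst C) S) l = 0"
  shows "\<exists>\<sigma>. \<forall>((v, e, m, n), u, w)\<in>set (zip C S). w = \<sigma> * e"
proof -
  define V where "V = concat (map visits (zip C S))"
  define T where "T l = (\<Sum>(k, t)\<leftarrow>V. t * of_bool (k = l))" for l
  have V: "k \<in> {1..N}" if "(k, t) \<in> set V" for k t
  proof -
    from that obtain x s where "(x, s) \<in> set (zip C S)" "(k, t) \<in> set (visits (x, s))"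
      by (auto simp: V_def)
    moreover from this(1) have "numbered_crossing N x" using C by (auto dest: set_zip_leftD)
    ultimately show ?thesis by (cases "(x, s)" rule: visits.cases) (auto split: if_splits)
  qed
  have fst_V: "map fst V = concat (map incoming C)"
    unfolding V_def using len
  proof (induction C S rule: list_induct2')
    case (4 x xs y ys)
    then show ?case by (cases "(x, y)" rule: visits.cases) auto
  qed auto
  have flow: "total_flow (zip (map fst C) S) l = (\<Sum>(k, t)\<leftarrow>V. t * (of_bool (l = k mod N + 1) -
      of_bool (l = k)))" for l
    unfolding V_def using len C
  proof (induction C S rule: list_induct2')
    case (4 x xs y ys)
    have "flow (fst x, y) l = (\<Sum>(k, t)\<leftarrow>visits (x, y). t * (of_bool (l = k mod N + 1) - of_bool (l
        = k)))"
      using 4(3) by (cases "(x, y)" rule: visits.cases) (auto simp: algebra_simps)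
    then show ?case using 4 by simp
  qed auto
  have step: "T (k mod N + 1) = T k" if k: "k \<in> {1..N}" for k
  proof -
    have "(\<Sum>(k', t)\<leftarrow>V. t * (of_bool (k mod N + 1 = k' mod N + 1) - of_bool (k mod N + 1 = k'))) =
        (\<Sum>(k', t)\<leftarrow>V. t * of_bool (k' = k) - t * of_bool (k' = k mod N + 1))"
      by (rule arg_cong[of _ _ sum_list], rule map_cong)
        (use next_inj[OF k] V in \<open>auto simp: algebra_simps\<close>)
    also have "\<dots> = T k - T (k mod N + 1)"
      unfolding T_def by (induction V) auto
    finally show ?thesis using bal[of "k mod N + 1"] flow[of "k mod N + 1"] by simp
  qed
  have const: "Suc k \<le> N \<Longrightarrow> T (Suc k) = T 1" for k
  proof (induction k)
    case (Suc k)
    then show ?case using step[of "Suc k"] by simp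
  qed simp
  have "w = T 1 * e" if "((v, e, m, n), u, w) \<in> set (zip C S)" for v e m n u w
  proof -
    have num: "numbered_crossing N (v, e, m, n)" using C that by (auto dest: set_zip_leftD)
    then obtain a b c d where v: "v = Crossing a b c d" by (cases v) auto
    have mem: "(if e = 1 then b else d, e * w) \<in> set V"
      using that unfolding V_def by (force simp: v)
    have "T (if e = 1 then b else d) = e * w"
      using sum_list_of_bool_distinct[OF _ mem] dist by (simp add: T_def fst_V)
    moreover have "T (if e = 1 then b else d) = T 1"
      using V[OF mem] const[of "(if e = 1 then b else d) - 1"] by simp
    moreover have "e = 1 \<or> e = - 1" using num by (auto simp: v)
    ultimately show ?thesis by auto
  qed
  then show ?thesis by (intro exI[of _ "T 1"]) auto
qed

text \<open>
  The combination of equations is linear in \<open>g\<close>, so it is determined by its values on indicator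
  functions.
\<close>

lemma dual_pairing:
  fixes g :: "nat \<Rightarrow> 'k::comm_ring_1"
  assumes "\<forall>x\<in>set C. numbered_crossing N x" "N > 0"
  shows "(\<Sum>x\<leftarrow>C. crossing_pairing g x) =
    (\<Sum>l\<in>{1..N}. g l * of_int (\<Sum>x\<leftarrow>C. crossing_pairing (\<lambda>k. of_bool (k = l)) x))"
  using assms(1)
proof (induction C)
  case (Cons x C)
  obtain v e m n where x: "x = (v, e, m, n)" by (cases x)
  then obtain a b c d where v: "v = Crossing a b c d" using Cons.prems by (cases v) auto
  have lab: "{a, b, c, d} \<subseteq> {1..N}"
    using Cons.prems assms(2) by (auto simp: x v Suc_leI)
  have g: "(\<Sum>l\<in>{1..N}. g l * of_bool (k = l)) = g k" if "k \<in> {1..N}" for k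
  proof -
    have "(\<Sum>l\<in>{1..N}. g l * of_bool (k = l)) = (\<Sum>l\<in>{1..N}. if k = l then g l else 0)"
      by (rule sum.cong) auto
    then show ?thesis using that by (simp add: sum.delta)
  qed
  have "g l * of_int (crossing_pairing (\<lambda>k. of_bool (k = l)) x) =
      of_int m * (g l * of_bool (c = l)) - of_int m * 2 * (g l * of_bool (b = l)) +
      of_int m * (g l * of_bool (a = l)) + of_int n * (g l * of_bool (b = l)) -
      of_int n * (g l * of_bool (d = l))" for l
    by (simp add: x v algebra_simps)
  then have "(\<Sum>l\<in>{1..N}. g l * of_int (crossing_pairing (\<lambda>k. of_bool (k = l)) x)) =
      of_int m * g c - of_int m * 2 * g b + of_int m * g a + of_int n * g b - of_int n * g d"
    using lab by (simp add: sum.distrib sum_subtractf g flip: sum_distrib_left)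
  also have "\<dots> = crossing_pairing g x" by (simp add: x v algebra_simps)
  finally have "crossing_pairing g x =
      (\<Sum>l\<in>{1..N}. g l * of_int (crossing_pairing (\<lambda>k. of_bool (k = l)) x))" ..
  then show ?case using Cons by (simp add: sum.distrib distrib_left)
qed simp

lemma certificate_not_liftable:
  assumes cert: "certificate (int CHAR('k::comm_ring_1)) N C Fs"
  shows "\<not> liftable TYPE('k) (map fst C)"
proof
  let ?p = "int CHAR('k)" and ?F = "\<lambda>l. Fs ! (l - 1)"
  note c = cert[unfolded certificate_def Let_def list_all_iff]
  have char: "of_int x = (0 :: 'k)" if "?p dvd x" for x
    using that by (simp add: of_int_eq_0_iff_char_dvd)
  have N: "N > 0" and C0: "C \<noteq> []" and C: "\<forall>x\<in>set C. numbered_crossing N x"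
    and fox_C: "\<forall>x\<in>set C. fox_mod ?p ?F x"
    using c by simp_all
  define f :: "nat \<Rightarrow> 'k" where "f l = of_int (?F l)" for l
  assume "liftable TYPE('k) (map fst C)"
  then obtain W where W: "map fst W = map fst C" "signed W" "\<forall>l. total_flow W l = 0"
    "\<And>f :: nat \<Rightarrow> 'k. \<forall>v\<in>set (map fst C). fox f v \<Longrightarrow> \<exists>g. \<forall>x\<in>set W. lift f g x"
    by (rule liftableE) (rule that)
  have fox_f: "fox f (fst x)" if "x \<in> set C" for x
  proof -
    obtain v e m n where x: "x = (v, e, m, n)" by (cases x)
    have "numbered_crossing N x" using C that by blast
    then obtain a b c d where v: "v = Crossing a b c d" unfolding x by (cases v) simp_all
    have "fox_mod ?p ?F x" using fox_C that by simp
    then have "?p dvd ?F b - ?F d" "?p dvd ?F c - (2 * ?F b - ?F a)" by (simp_all add: x v)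
    from this[THEN char] show ?thesis by (simp add: x v f_def fox_at_def)
  qed
  then obtain g where g: "\<forall>x\<in>set W. lift f g x" using W(4)[of f] by auto
  define S where "S = map snd W"
  have len: "length S = length C" using arg_cong[OF W(1), of length] by (simp add: S_def)
  have zipW: "W = zip (map fst C) S" unfolding S_def W(1)[symmetric] by (rule
      zip_map_fst_snd[symmetric])
  obtain \<sigma> where \<sigma>: "\<forall>((v, e, m, n), u, w)\<in>set (zip C S). w = \<sigma> * e"
    using numbered_orientation[OF N C _ len] c W(3) zipW by auto
  have "crossing_pairing g x = of_int \<sigma> * of_int (fst (snd x) * crossing_jump ?F x)"
    if x: "x \<in> set C" for x
  proof -
    obtain i where i: "i < length C" "x = C ! i" using x by (auto simp: in_set_conv_nth)
    obtain u w where s: "S ! i = (u, w)" by (cases "S ! i")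
    have mem: "(x, u, w) \<in> set (zip C S)"
      using i s len by (auto simp: in_set_zip)
    obtain v e m n where x': "x = (v, e, m, n)" by (cases x)
    have "numbered_crossing N x" using C x by blast
    then obtain a b c d where v: "v = Crossing a b c d" unfolding x' by (cases v) simp_all
    have w: "w = \<sigma> * e" using \<sigma> mem by (auto simp: x')
    have "fst (C ! i) = v" using i(2) x' by (metis fst_conv)
    then have "zip (map fst C) S ! i = (v, u, w)" "i < length (zip (map fst C) S)"
      using i(1) s len by simp_all
    then have "(v, u, w) \<in> set W" unfolding zipW by (metis nth_mem)
    then have "lift f g (v, u, w)" using g by blast
    then have 1: "g b = g d" "g c - 2 * g b + g a = of_int w * 2 * (f c - f b)"
      by (simp_all add: v lift_at_def)
    have "crossing_pairing g x = of_int m * (g c - 2 * g b + g a) + of_int n * (g b - g d)"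
      by (simp add: x' v)
    then show ?thesis unfolding 1(2) using 1(1) by (simp add: x' v w f_def algebra_simps)
  qed
  then have "(\<Sum>x\<leftarrow>C. crossing_pairing g x) =
      (\<Sum>x\<leftarrow>C. of_int \<sigma> * of_int (fst (snd x) * crossing_jump ?F x))"
    by (intro arg_cong[of _ _ sum_list] map_cong) auto
  also have "\<dots> = of_int \<sigma> * of_int (\<Sum>x\<leftarrow>C. fst (snd x) * crossing_jump ?F x)"
    by (induction C) (simp_all add: algebra_simps)
  also have "(\<Sum>x\<leftarrow>C. fst (snd x) * crossing_jump ?F x) = (\<Sum>(v, e, m, n)\<leftarrow>C. e * crossing_jump ?F (v,
      e, m, n))"
    by (rule arg_cong[of _ _ sum_list], rule map_cong) auto
  also have "(of_int \<dots> :: 'k) = of_int 1"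
  proof -
    let ?s = "\<Sum>(v, e, m, n)\<leftarrow>C. e * crossing_jump ?F (v, e, m, n)"
    have "?p dvd ?s - ?s mod ?p" by (simp add: minus_mod_eq_mult_div)
    from char[OF this] show ?thesis using c by simp
  qed
  finally have "of_int \<sigma> = (\<Sum>x\<leftarrow>C. crossing_pairing g x)" by simp
  also have "\<dots> = (\<Sum>l\<in>{1..N}. g l * of_int (\<Sum>x\<leftarrow>C. crossing_pairing (\<lambda>k. of_bool (k = l)) x))"
    by (rule dual_pairing[OF C N])
  also have "\<dots> = 0"
  proof (rule sum.neutral, rule ballI)
    fix l assume "l \<in> {1..N}"
    then have "l \<in> set [1..<Suc N]" by auto
    with c have "?p dvd (\<Sum>x\<leftarrow>C. crossing_pairing (\<lambda>k. of_bool (k = l)) x)" by blast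
    from char[OF this] show "g l * of_int (\<Sum>x\<leftarrow>C. crossing_pairing (\<lambda>k. of_bool (k = l)) x) = 0"
      by simp
  qed
  finally have "of_int \<sigma> = (0 :: 'k)" .
  moreover have "\<sigma> \<in> {1, - 1}"
  proof -
    obtain x C' where C': "C = x # C'" using C0 by (cases C) auto
    obtain v e m n where x: "x = (v, e, m, n)" by (cases x)
    obtain u w S' where S': "S = (u, w) # S'" using len C' by (cases S) auto
    have "w = \<sigma> * e" using \<sigma> by (simp add: C' S' x)
    moreover have "e = 1 \<or> e = - 1" using C by (cases v) (auto simp: C' x)
    moreover have "w = 1 \<or> w = - 1" using W(2) unfolding zipW by (simp add: C' S' x)
    ultimately show ?thesis by auto
  qed
  ultimately show False by auto
qed

section \<open>The twelve knots\<close>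

lemma not_bipartite:
  fixes D :: diagram
  assumes "certificate (int CHAR('k::{finite, comm_ring_1})) N (zip D ws) Fs" "length ws = length
      D"
  shows "\<not> bipartite (knot_of D)"
proof
  assume "bipartite (knot_of D)"
  then obtain D' where D': "D' \<in> knot_of D" "matched D'" unfolding bipartite_def by blast
  then have "liftable TYPE('k) D'" by (intro matched_liftable) (simp_all add: knot_of_def)
  then have "liftable TYPE('k) D" using liftable_knot_of[OF D'(1), where 'k = 'k] by simp
  then show False using certificate_not_liftable[OF assms(1)] assms(2) by simp
qed

lemma CHAR_3_5_7: "int CHAR(3) = 3" "int CHAR(5) = 5" "int CHAR(7) = 7"
  by simp_all

lemma rolfsen_9_35_not_bipartite: "\<not> bipartite rolfsen_9_35"
  unfolding rolfsen_9_35_def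
proof (rule not_bipartite[where 'k = 3 and N = 18 and
      ws = "[(- 1, - 1, 1), (- 1, 0, 0), (- 1, - 1, 0), (- 1, 0, 1), (- 1, 1, - 1), (- 1, 0, 0),
          (- 1, 0, 0), (- 1, 1, 0), (- 1, 0, - 1)]" and
      Fs = "[0, 0, 1, 1, 2, 2, 0, 0, 0, 0, 0, 0, 2, 2, 1, 1, 0, 0]"], unfold CHAR_3_5_7)
qed code_simp+

lemma rolfsen_9_37_not_bipartite: "\<not> bipartite rolfsen_9_37"
  unfolding rolfsen_9_37_def
proof (rule not_bipartite[where 'k = 3 and N = 18 and
      ws = "[(- 1, 0, 0), (1, 0, 0), (- 1, 1, 0), (- 1, 0, - 1), (1, - 1, 0), (1, 0, 0), (- 1, -
          1, 0), (- 1, 0, 1), (1, 1, 0)]" and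
      Fs = "[2, 2, 1, 1, 0, 0, 0, 0, 2, 2, 0, 0, 0, 0, 0, 0, 1, 1]"], unfold CHAR_3_5_7)
qed code_simp+

lemma rolfsen_9_41_not_bipartite: "\<not> bipartite rolfsen_9_41"
  unfolding rolfsen_9_41_def
proof (rule not_bipartite[where 'k = 7 and N = 18 and
      ws = "[(- 1, - 1, - 2), (1, 0, 0), (1, 3, - 1), (- 1, 0, - 1), (1, - 3, 0), (1, 0, 0), (- 1,
          - 2, 0), (1, 0, - 3), (1, 1, - 2)]" and
      Fs = "[5, 5, 0, 0, 0, 0, 3, 3, 1, 1, 6, 6, 0, 0, 0, 0, 2, 2]"], unfold CHAR_3_5_7)
qed code_simp+

lemma rolfsen_9_46_not_bipartite: "\<not> bipartite rolfsen_9_46"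
  unfolding rolfsen_9_46_def
proof (rule not_bipartite[where 'k = 3 and N = 18 and
      ws = "[(- 1, 0, 0), (- 1, 1, 0), (1, 1, 0), (1, 0, - 1), (- 1, 0, 0), (- 1, - 1, 0), (- 1,
          0, 1), (1, - 1, 0), (- 1, 0, 0)]" and
      Fs = "[0, 0, 0, 0, 0, 2, 2, 1, 2, 2, 0, 0, 0, 0, 0, 1, 1, 1]"], unfold CHAR_3_5_7)
qed code_simp+

lemma rolfsen_9_47_not_bipartite: "\<not> bipartite rolfsen_9_47"
  unfolding rolfsen_9_47_def
proof (rule not_bipartite[where 'k = 3 and N = 18 and
      ws = "[(- 1, - 1, 0), (1, 1, 1), (- 1, 0, 1), (- 1, 0, - 1), (1, - 1, 0), (- 1, 0, 0), (- 1,
          1, 0), (1, 1, 0), (- 1, 0, 0)]" and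
      Fs = "[0, 0, 0, 0, 1, 1, 2, 2, 1, 1, 1, 2, 2, 2, 0, 0, 1, 0]"], unfold CHAR_3_5_7)
qed code_simp+

lemma rolfsen_9_48_not_bipartite: "\<not> bipartite rolfsen_9_48"
  unfolding rolfsen_9_48_def
proof (rule not_bipartite[where 'k = 3 and N = 18 and
      ws = "[(- 1, - 1, 0), (1, 0, - 1), (1, 1, 0), (1, 0, - 1), (1, 0, 0), (1, 1, - 1), (1, - 1,
          0), (- 1, 0, 0), (1, 0, 0)]" and
      Fs = "[2, 2, 1, 1, 0, 0, 0, 0, 2, 2, 0, 0, 0, 0, 0, 0, 1, 1]"], unfold CHAR_3_5_7)
qed code_simp+

lemma rolfsen_9_49_not_bipartite: "\<not> bipartite rolfsen_9_49"
  unfolding rolfsen_9_49_def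
proof (rule not_bipartite[where 'k = 5 and N = 18 and
      ws = "[(- 1, 2, - 1), (- 1, 0, 0), (- 1, - 2, 2), (- 1, 0, 2), (- 1, 0, - 1), (- 1, 0, 0),
          (- 1, - 1, 0), (- 1, - 1, 0), (- 1, 1, 2)]" and
      Fs = "[4, 4, 4, 0, 0, 0, 3, 3, 3, 2, 2, 1, 0, 0, 0, 0, 0, 1]"], unfold CHAR_3_5_7)
qed code_simp+

lemma rolfsen_10_74_not_bipartite: "\<not> bipartite rolfsen_10_74"
  unfolding rolfsen_10_74_def
proof (rule not_bipartite[where 'k = 3 and N = 20 and
      ws = "[(- 1, 0, 1), (1, 1, 0), (- 1, 0, 0), (- 1, 0, 0), (- 1, 1, 0), (- 1, 0, - 1), (1, -
          1, 0), (- 1, 0, 0), (- 1, 0, 0), (- 1, - 1, 0)]" and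
      Fs = "[0, 0, 0, 0, 0, 0, 2, 2, 1, 1, 0, 0, 0, 0, 0, 0, 1, 1, 2, 2]"], unfold CHAR_3_5_7)
qed code_simp+

lemma rolfsen_10_75_not_bipartite: "\<not> bipartite rolfsen_10_75"
  unfolding rolfsen_10_75_def
proof (rule not_bipartite[where 'k = 3 and N = 20 and
      ws = "[(- 1, 0, 0), (1, 0, 0), (- 1, 0, 0), (1, - 1, 1), (1, - 1, 0), (1, 0, 0), (- 1, 1,
          0), (1, 0, 1), (- 1, 0, 1), (1, 1, 0)]" and
      Fs = "[2, 2, 1, 1, 0, 0, 0, 0, 2, 2, 0, 0, 0, 0, 0, 0, 0, 0, 1, 1]"], unfold CHAR_3_5_7)
qed code_simp+

lemma rolfsen_10_103_not_bipartite: "\<not> bipartite rolfsen_10_103"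
  unfolding rolfsen_10_103_def
proof (rule not_bipartite[where 'k = 5 and N = 20 and
      ws = "[(- 1, 0, - 1), (1, 0, - 1), (- 1, 2, - 1), (1, 0, 0), (1, 0, 0), (1, - 1, - 2), (1, -
          1, 0), (1, 0, 0), (- 1, 1, 0), (1, - 2, - 1)]" and
      Fs = "[1, 1, 0, 0, 0, 0, 2, 2, 0, 0, 0, 0, 4, 4, 1, 1, 3, 3, 2, 2]"], unfold CHAR_3_5_7)
qed code_simp+

lemma rolfsen_10_155_not_bipartite: "\<not> bipartite rolfsen_10_155"
  unfolding rolfsen_10_155_def
proof (rule not_bipartite[where 'k = 5 and N = 20 and
      ws = "[(- 1, 0, 1), (1, 0, 1), (1, - 2, 0), (- 1, 0, 0), (- 1, 0, 0), (1, 1, 2), (1, 2, -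
          1), (1, - 1, 0), (- 1, 0, 0), (1, 0, 2)]" and
      Fs = "[2, 2, 0, 0, 0, 0, 4, 4, 0, 0, 0, 0, 0, 4, 1, 1, 2, 2, 3, 2]"], unfold CHAR_3_5_7)
qed code_simp+

lemma rolfsen_10_157_not_bipartite: "\<not> bipartite rolfsen_10_157"
  unfolding rolfsen_10_157_def
proof (rule not_bipartite[where 'k = 7 and N = 20 and
      ws = "[(- 1, 0, - 1), (1, 1, 2), (1, 0, 3), (1, 0, 0), (1, 0, 1), (- 1, 2, 0), (1, - 1, 0),
          (1, 0, 0), (1, - 3, 0), (1, - 2, - 1)]" and
      Fs = "[0, 0, 0, 1, 1, 6, 1, 1, 3, 4, 4, 0, 0, 0, 2, 2, 2, 0, 0, 0]"], unfold CHAR_3_5_7)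
qed code_simp+

theorem mainTheorem5:
  shows "\<forall>K \<in> {rolfsen_9_35, rolfsen_9_37, rolfsen_9_41, rolfsen_9_46, rolfsen_9_47, rolfsen_9_48,
                rolfsen_9_49, rolfsen_10_74, rolfsen_10_75, rolfsen_10_103, rolfsen_10_155,
                rolfsen_10_157}. \<not> bipartite K"
  by (simp add: rolfsen_9_35_not_bipartite rolfsen_9_37_not_bipartite rolfsen_9_41_not_bipartite
      rolfsen_9_46_not_bipartite rolfsen_9_47_not_bipartite rolfsen_9_48_not_bipartite
      rolfsen_9_49_not_bipartite rolfsen_10_74_not_bipartite rolfsen_10_75_not_bipartite
      rolfsen_10_103_not_bipartite rolfsen_10_155_not_bipartite rolfsen_10_157_not_bipartite)

end
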